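(* Let $\beta_1,\beta_2\ge 0$ and for each $n$ let $\mathbf{X}\sim\mathbb{P}_{\beta_1,\mathbf{Q}^{\mathrm{CW}}}$ and $\mathbf{Y}\sim\mathbb{P}_{\beta_2,\mathbf{Q}^{\mathrm{CW}}}$ be independent. Then $$\sqrt{n}\,T_n\xrightarrow{d} N\big(0,(1-m_1^2)(1-m_2^2)\big),$$ where for $i=1,2$, $m_i=0$ if $\beta_i\le 1$ and otherwise $m_i$ is the unique positive root of $m=\tanh(\beta_i m)$. In particular the limiting variance equals $1$ if and only if $\beta_1,\beta_2\le1$, and is strictly less than $1$ otherwise.
   Context: Ising model: for an $n\times n$ symmetric matrix $\mathbf{Q}_n$ with zero diagonal and $\beta\ge0$, $\mathbb{P}_{\beta,\mathbf{Q}_n}(\mathbf{Z}=\mathbf{z})=Z(\beta,\mathbf{Q}_n)^{-1}\exp\big(\tfrac{\beta}{2}\mathbf{z}^\top\mathbf{Q}_n\mathbf{z}\big)$ for $\mathbf{z}\in\{\pm1\}^n$. Curie–Weiss model: $\mathbf{Q}^{\mathrm{CW}}=\frac1n(\mathbf{1}\mathbf{1}^\top-I_n)$. Sample covariance: $T_n=\frac1n\sum_{i=1}^n (X_i-\overline{\mathbf{X}}_n)(Y_i-\overline{\mathbf{Y}}_n)$ with $\overline{\mathbf{X}}_n,\overline{\mathbf{Y}}_n$ the sample means. *)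

theory Defs
  imports "HOL-Probability.Probability"
begin

definition spins :: "nat \<Rightarrow> (nat \<Rightarrow> real) set" where
  "spins n = {z. (\<forall>i<n. z i = -1 \<or> z i = 1) \<and> (\<forall>i\<ge>n. z i = 0)}"

definition Q_CW :: "nat \<Rightarrow> nat \<Rightarrow> nat \<Rightarrow> real" where
  "Q_CW n i j = (if i = j then 0 else 1 / real n)"

definition ising_weight :: "real \<Rightarrow> (nat \<Rightarrow> nat \<Rightarrow> real) \<Rightarrow> nat \<Rightarrow> (nat \<Rightarrow> real) \<Rightarrow> real" where
  "ising_weight \<beta> Q n z = exp (\<beta> / 2 * (\<Sum>i<n. \<Sum>j<n. z i * Q i j * z j))"

definition partition_fun :: "real \<Rightarrow> (nat \<Rightarrow> nat \<Rightarrow> real) \<Rightarrow> nat \<Rightarrow> real" where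
  "partition_fun \<beta> Q n = (\<Sum>z\<in>spins n. ising_weight \<beta> Q n z)"

definition ising_measure :: "real \<Rightarrow> (nat \<Rightarrow> nat \<Rightarrow> real) \<Rightarrow> nat \<Rightarrow> (nat \<Rightarrow> real) measure" where
  "ising_measure \<beta> Q n = point_measure (spins n)
     (\<lambda>z. ennreal (ising_weight \<beta> Q n z / partition_fun \<beta> Q n))"

definition curie_weiss :: "real \<Rightarrow> nat \<Rightarrow> (nat \<Rightarrow> real) measure" where
  "curie_weiss \<beta> n = ising_measure \<beta> (Q_CW n) n"

definition sample_mean :: "nat \<Rightarrow> (nat \<Rightarrow> real) \<Rightarrow> real" where
  "sample_mean n x = (\<Sum>i<n. x i) / real n"

definition sample_cov :: "nat \<Rightarrow> (nat \<Rightarrow> real) \<Rightarrow> (nat \<Rightarrow> real) \<Rightarrow> real" where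
  "sample_cov n x y = (\<Sum>i<n. (x i - sample_mean n x) * (y i - sample_mean n y)) / real n"

definition cw_mag :: "real \<Rightarrow> real" where
  "cw_mag \<beta> = (if \<beta> \<le> 1 then 0 else THE m. m > 0 \<and> m = tanh (\<beta> * m))"

definition scaled_cov_law :: "real \<Rightarrow> real \<Rightarrow> nat \<Rightarrow> real measure" where
  "scaled_cov_law \<beta>1 \<beta>2 n =
     distr (curie_weiss \<beta>1 n \<Otimes>\<^sub>M curie_weiss \<beta>2 n) borel
       (\<lambda>(x, y). sqrt (real n) * sample_cov n x y)"

end

theory Submission
  imports Defs "HOL-Real_Asymp.Real_Asymp"
begin

text \<open>
  By the Hubbard--Stratonovich transform, the Curie--Weiss law is a mixture of i.i.d. laws: with
  \<open>b = sqrt \<beta>\<close>, draw \<open>g\<close> with density proportional to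
  \<open>exp (- n * (g\<^sup>2 / 2 - ln (cosh (b * g))))\<close>, and then the spins independently with mean
  \<open>\<mu> = tanh (b * g)\<close>. Laplace's method shows that \<open>\<mu>\<^sup>2\<close>
  concentrates at the square of the magnetization \<open>m\<close>, and so does the squared sample mean.

  Fix \<open>X = x\<close> and let \<open>a\<close> be its sample mean. Since the deviations \<open>x i - a\<close> sum to
  \<open>0\<close>, the scaled covariance is the sum of \<open>(x i - a) * (Y i - \<mu>) / sqrt n\<close> for every
  \<open>\<mu>\<close>. Under the i.i.d. law of mean \<open>\<mu>\<close> this is a sum of independent centred bounded variables
  of total variance \<open>(1 - a\<^sup>2) * (1 - \<mu>\<^sup>2)\<close>, so its characteristic function is within
  \<open>O(1 / sqrt n)\<close> of the Gaussian one, uniformly in \<open>x\<close> and \<open>\<mu>\<close>. Averaging over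
  \<open>\<mu>\<close> and \<open>x\<close> and applying Levy's continuity theorem gives the limit.
\<close>

subsection \<open>The magnetization\<close>

lemma tanh_less_self:
  fixes x :: real
  assumes "x > 0"
  shows "tanh x < x"
proof -
  have "(\<lambda>x. x - tanh x) 0 < (\<lambda>x. x - tanh x) x"
  proof (rule DERIV_pos_imp_increasing_open[OF assms])
    fix y :: real assume "0 < y" "y < x"
    have "((\<lambda>x. x - tanh x) has_real_derivative (tanh y)\<^sup>2) (at y)"
      by (auto intro!: derivative_eq_intros)
    then show "\<exists>D. ((\<lambda>x. x - tanh x) has_real_derivative D) (at y) \<and> 0 < D"
      using \<open>0 < y\<close> by (intro exI[of _ "(tanh y)\<^sup>2"]) auto
  qed (auto intro!: continuous_intros)
  then show ?thesis by simp
qed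

text \<open>The function \<open>f w = w - tanh (\<beta> * w)\<close> starts at 0, decreases up to
  its critical point \<open>c\<close> and increases afterwards, so it crosses zero exactly once on
  the positive axis. The signs on both sides of the root give its uniqueness and, later, the
  monotonicity of the potential.\<close>

lemma curie_weiss_root:
  fixes \<beta> :: real
  assumes "\<beta> > 1"
  obtains m where "m > 0" "m = tanh (\<beta> * m)"
    "\<And>w. 0 < w \<Longrightarrow> w < m \<Longrightarrow> w < tanh (\<beta> * w)" "\<And>w. m < w \<Longrightarrow> tanh (\<beta> * w) < w"
proof -
  define f where "f w = w - tanh (\<beta> * w)" for w
  have f0: "f 0 = 0" by (simp add: f_def)
  have f1: "f 1 > 0" using tanh_real_lt_1[of \<beta>] by (simp add: f_def)
  have cont: "continuous_on A f" for A
    unfolding f_def by (intro continuous_intros) auto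
  have der: "(f has_real_derivative 1 - \<beta> * (1 - (tanh (\<beta> * w))\<^sup>2)) (at w)" for w
    unfolding f_def by (auto intro!: derivative_eq_intros)
  \<comment> \<open>The derivative \<open>1 - \<beta> * (1 - (tanh (\<beta> * w))\<^sup>2)\<close>
    vanishes exactly when \<open>tanh (\<beta> * w)\<close> is \<open>s\<close> in absolute value,
    so the turning point \<open>c\<close> is found by inverting \<open>tanh\<close> at
    \<open>s\<close>.\<close>
  define s where "s = sqrt (1 - 1 / \<beta>)"
  have s: "0 < s" "s < 1" "s\<^sup>2 = 1 - 1 / \<beta>" using assms by (auto simp: s_def)
  define c where "c = artanh s / \<beta>"
  have tc: "tanh (\<beta> * c) = s"
  proof -
    have "eventually (\<lambda>x. tanh x > s) at_top"
      using tanh_real_at_top s(2) by (rule order_tendstoD)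
    then obtain y where "y \<ge> 0" "tanh y > s"
      by (metis eventually_at_top_linorder linorder_linear order_refl)
    then obtain x where "tanh x = s"
      using IVT'[of tanh 0 s y] s by (force intro!: continuous_intros)
    then have "artanh s = x" using artanh_tanh_real by blast
    then show ?thesis using \<open>tanh x = s\<close> assms by (simp add: c_def)
  qed
  have cpos: "c > 0"
    using s(1) tc assms by (metis tanh_real_pos_iff zero_less_mult_pos not_less order.strict_trans zero_less_one)
  have dneg: "f w < f u" if "0 \<le> u" "u < w" "w \<le> c" for u w
  proof (rule DERIV_neg_imp_decreasing_open[OF that(2) _ cont])
    fix x assume x: "u < x" "x < w"
    have "tanh (\<beta> * x) < s" "tanh (\<beta> * x) > 0"
      using x that assms unfolding tc[symmetric] by auto
    then have "(tanh (\<beta> * x))\<^sup>2 < 1 - 1 / \<beta>"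
      unfolding s(3)[symmetric] by (intro power_strict_mono) auto
    then have "1 - \<beta> * (1 - (tanh (\<beta> * x))\<^sup>2) < 0"
      using assms by (simp add: field_simps)
    then show "\<exists>y. (f has_real_derivative y) (at x) \<and> y < 0" using der by blast
  qed
  have dpos: "f u < f w" if "c \<le> u" "u < w" for u w
  proof (rule DERIV_pos_imp_increasing_open[OF that(2) _ cont])
    fix x assume x: "u < x" "x < w"
    have "s < tanh (\<beta> * x)"
      using x that assms unfolding tc[symmetric] by auto
    then have "1 - 1 / \<beta> < (tanh (\<beta> * x))\<^sup>2"
      unfolding s(3)[symmetric] using s(1) by (intro power_strict_mono) auto
    then have "1 - \<beta> * (1 - (tanh (\<beta> * x))\<^sup>2) > 0"
      using assms by (simp add: field_simps)
    then show "\<exists>y. (f has_real_derivative y) (at x) \<and> 0 < y" using der by blast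
  qed
  have fc: "f c < 0" using dneg[of 0 c] cpos f0 by simp
  \<comment> \<open>Otherwise \<open>f\<close> would decrease on the whole of [0, 1], against
    \<open>f 0 = 0 < f 1\<close>. This places the root in [c, 1].\<close>
  have "c \<le> 1"
  proof (rule ccontr)
    assume "\<not> c \<le> 1"
    then show False using dneg[of 0 1] f0 f1 by simp
  qed
  then obtain m where m: "c \<le> m" "m \<le> 1" "f m = 0"
    using IVT'[of f c 0 1] fc f1 cont by force
  then have cm: "c < m" using fc by (cases "c = m") auto
  show thesis
  proof (rule that[of m])
    show "m > 0" using cm cpos by simp
    show "m = tanh (\<beta> * m)" using m by (simp add: f_def)
    show "w < tanh (\<beta> * w)" if "0 < w" "w < m" for w
    proof (cases "w \<le> c")
      case True
      then have "f w < f 0" using dneg[of 0 w] that by simp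
      then show ?thesis using f0 by (simp add: f_def)
    next
      case False
      then have "f w < f m" using dpos[of w m] that by simp
      then show ?thesis using m by (simp add: f_def)
    qed
    show "tanh (\<beta> * w) < w" if "m < w" for w
    proof -
      have "f m < f w" using dpos[of m w] that cm by simp
      then show ?thesis using m by (simp add: f_def)
    qed
  qed
qed

text \<open>For \<open>\<beta> \<le> 1\<close> this follows from
  \<open>tanh (\<beta> * w) \<le> tanh w < w\<close>, the interval below the magnetization being
  empty. For \<open>\<beta> > 1\<close> the sign conditions make the root unique, so the definite
  description in \<open>cw_mag\<close> denotes it. From here on only these properties of
  \<open>cw_mag\<close> are used.\<close>

lemma cw_mag_characterization:
  fixes \<beta> :: real
  assumes "\<beta> \<ge> 0"
  shows "0 \<le> cw_mag \<beta>" "cw_mag \<beta> < 1" "tanh (\<beta> * cw_mag \<beta>) = cw_mag \<beta>"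
    "\<And>w. 0 < w \<Longrightarrow> w < cw_mag \<beta> \<Longrightarrow> w < tanh (\<beta> * w)" "\<And>w. cw_mag \<beta> < w \<Longrightarrow> tanh (\<beta> * w) < w"
    "cw_mag \<beta> = 0 \<longleftrightarrow> \<beta> \<le> 1"
proof -
  have "0 \<le> cw_mag \<beta> \<and> cw_mag \<beta> < 1 \<and> tanh (\<beta> * cw_mag \<beta>) = cw_mag \<beta> \<and>
    (\<forall>w. 0 < w \<longrightarrow> w < cw_mag \<beta> \<longrightarrow> w < tanh (\<beta> * w)) \<and> (\<forall>w. cw_mag \<beta> < w \<longrightarrow> tanh (\<beta> * w) < w) \<and>
    (cw_mag \<beta> = 0 \<longleftrightarrow> \<beta> \<le> 1)"
  proof (cases "\<beta> \<le> 1")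
    case True
    have "tanh (\<beta> * w) < w" if "0 < w" for w
    proof -
      have "tanh (\<beta> * w) \<le> tanh w"
        using that True assms by (simp add: mult_left_le_one_le)
      then show ?thesis using tanh_less_self[OF that] by (rule le_less_trans)
    qed
    then show ?thesis using True by (simp add: cw_mag_def)
  next
    case False
    then obtain m where m: "m > 0" "m = tanh (\<beta> * m)"
      "\<And>w. 0 < w \<Longrightarrow> w < m \<Longrightarrow> w < tanh (\<beta> * w)" "\<And>w. m < w \<Longrightarrow> tanh (\<beta> * w) < w"
      using curie_weiss_root[of \<beta>] by (metis not_le)
    have "cw_mag \<beta> = m"
      unfolding cw_mag_def using False m
      by (auto intro!: the_equality) (metis linorder_neqE_linordered_idom less_irrefl)
    moreover have "m < 1" using m(2) tanh_real_lt_1 by metis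
    ultimately show ?thesis using m False by auto
  qed
  then show "0 \<le> cw_mag \<beta>" "cw_mag \<beta> < 1" "tanh (\<beta> * cw_mag \<beta>) = cw_mag \<beta>"
    "\<And>w. 0 < w \<Longrightarrow> w < cw_mag \<beta> \<Longrightarrow> w < tanh (\<beta> * w)" "\<And>w. cw_mag \<beta> < w \<Longrightarrow> tanh (\<beta> * w) < w"
    "cw_mag \<beta> = 0 \<longleftrightarrow> \<beta> \<le> 1"
    by blast+
qed

subsection \<open>Concentration at the minimizers of the potential\<close>

text \<open>With \<open>b = sqrt \<beta>\<close> and \<open>g = b * w\<close>, the critical equation
  \<open>g = b * tanh (b * g)\<close> becomes the mean-field equation
  \<open>w = tanh (\<beta> * w)\<close> when \<open>b > 0\<close>.\<close>

definition cw_potential :: "real \<Rightarrow> real \<Rightarrow> real" where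
  "cw_potential b g = g\<^sup>2 / 2 - ln (cosh (b * g))"

lemma continuous_on_cw_potential: "continuous_on A (cw_potential b)"
  unfolding cw_potential_def by (intro continuous_intros) auto

lemma cw_potential_abs: "cw_potential b \<bar>g\<bar> = cw_potential b g"
  by (auto simp: cw_potential_def abs_if)

lemma has_derivative_cw_potential:
  "(cw_potential b has_real_derivative g - b * tanh (b * g)) (at g)"
  unfolding cw_potential_def
  by (auto intro!: derivative_eq_intros simp: tanh_def field_simps)

text \<open>For \<open>b > 0\<close> put \<open>w = x / b\<close>: the derivative
  \<open>x - b * tanh (b * x)\<close> has the sign of \<open>w - tanh (\<beta> * w)\<close>, which
  is known on both sides of the magnetization. For \<open>b = 0\<close> the potential is just half a
  square.\<close>

lemma cw_potential_monotone:
  fixes \<beta> :: real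
  assumes "\<beta> \<ge> 0"
  defines "b \<equiv> sqrt \<beta>"
  shows "\<And>g h. 0 \<le> g \<Longrightarrow> g < h \<Longrightarrow> h \<le> b * cw_mag \<beta> \<Longrightarrow> cw_potential b h < cw_potential b g"
    and "\<And>g h. b * cw_mag \<beta> \<le> g \<Longrightarrow> g < h \<Longrightarrow> cw_potential b g < cw_potential b h"
proof -
  note m = cw_mag_characterization[OF assms(1)]
  have b: "b \<ge> 0" "b * b = \<beta>" using assms by (auto simp: b_def)
  show "cw_potential b h < cw_potential b g" if "0 \<le> g" "g < h" "h \<le> b * cw_mag \<beta>" for g h
  proof (rule DERIV_neg_imp_decreasing_open[OF that(2) _ continuous_on_cw_potential])
    fix x assume x: "g < x" "x < h"
    have bp: "b > 0" using x that b by (cases "b = 0") auto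
    have "x / b < tanh (\<beta> * (x / b))"
      using x that bp by (intro m(4)) (auto simp: field_simps)
    also have "\<beta> * (x / b) = b * x" using bp unfolding b(2)[symmetric] by simp
    finally have "x - b * tanh (b * x) < 0" using bp by (simp add: field_simps)
    then show "\<exists>y. (cw_potential b has_real_derivative y) (at x) \<and> y < 0"
      using has_derivative_cw_potential by blast
  qed
  show "cw_potential b g < cw_potential b h" if "b * cw_mag \<beta> \<le> g" "g < h" for g h
  proof (rule DERIV_pos_imp_increasing_open[OF that(2) _ continuous_on_cw_potential])
    fix x assume x: "g < x" "x < h"
    have "x - b * tanh (b * x) > 0"
    proof (cases "b = 0")
      case True
      then show ?thesis using x that by simp
    next
      case False
      then have bp: "b > 0" using b by simp
      have "tanh (\<beta> * (x / b)) < x / b"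
        using x that bp by (intro m(5)) (auto simp: field_simps)
      also have "\<beta> * (x / b) = b * x" using bp unfolding b(2)[symmetric] by simp
      finally show ?thesis using bp by (simp add: field_simps)
    qed
    then show "\<exists>y. (cw_potential b has_real_derivative y) (at x) \<and> 0 < y"
      using has_derivative_cw_potential by blast
  qed
qed

text \<open>Measuring distance through the even function \<open>(tanh (b * g))\<^sup>2\<close>
  treats the minimizers \<open>b * m\<close> and \<open>- b * m\<close> at once: the potential is
  even too, so it suffices to look at \<open>\<bar>g\<bar>\<close>, where monotonicity bounds the
  potential from below away from \<open>g0\<close>.\<close>

lemma cw_potential_separation:
  fixes \<beta> \<epsilon> :: real
  assumes "\<beta> \<ge> 0" "\<epsilon> > 0"
  defines "b \<equiv> sqrt \<beta>"
  shows "\<exists>\<eta>>0. \<forall>g. \<epsilon> \<le> \<bar>(tanh (b * g))\<^sup>2 - (cw_mag \<beta>)\<^sup>2\<bar> \<longrightarrow>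
    cw_potential b (b * cw_mag \<beta>) + \<eta> \<le> cw_potential b g"
proof -
  note m = cw_mag_characterization[OF assms(1)]
  note mono = cw_potential_monotone[OF assms(1), folded b_def]
  have b: "b \<ge> 0" "b * b = \<beta>" using assms by (auto simp: b_def)
  define g0 where "g0 = b * cw_mag \<beta>"
  have g0: "g0 \<ge> 0" using b m by (simp add: g0_def)
  define h where "h g = (tanh (b * g))\<^sup>2" for g
  have h0: "h g0 = (cw_mag \<beta>)\<^sup>2"
    using m(3) b by (simp add: h_def g0_def mult.assoc[symmetric])
  have "isCont h g0" unfolding h_def by (intro continuous_intros) auto
  then obtain \<delta> where \<delta>: "\<delta> > 0" "\<And>g. \<bar>g - g0\<bar> < \<delta> \<Longrightarrow> \<bar>h g - h g0\<bar> < \<epsilon>"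
    using assms(2) unfolding continuous_at_eps_delta by (metis dist_real_def)
  \<comment> \<open>The smaller of the increments at distance \<open>\<delta>\<close> to the right
    and to the left of \<open>g0\<close>. If \<open>g0 - \<delta> < 0\<close>, no
    \<open>\<bar>g\<bar>\<close> lies that far to the left, and 1 is a dummy value.\<close>
  define \<eta> where "\<eta> = min (cw_potential b (g0 + \<delta>) - cw_potential b g0)
    (if g0 - \<delta> \<ge> 0 then cw_potential b (g0 - \<delta>) - cw_potential b g0 else 1)"
  have "\<eta> > 0"
    using mono(2)[of g0 "g0 + \<delta>"] mono(1)[of "g0 - \<delta>" g0] \<delta>(1) by (auto simp: \<eta>_def g0_def)
  moreover have "cw_potential b g0 + \<eta> \<le> cw_potential b g" if "\<epsilon> \<le> \<bar>h g - h g0\<bar>" for g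
  proof -
    have "h \<bar>g\<bar> = h g" by (auto simp: h_def abs_if)
    then have far: "\<delta> \<le> \<bar>\<bar>g\<bar> - g0\<bar>" using that \<delta>(2)[of "\<bar>g\<bar>"] by (metis not_less)
    have "cw_potential b g0 + \<eta> \<le> cw_potential b \<bar>g\<bar>"
    proof (cases "\<bar>g\<bar> \<ge> g0")
      case True
      then have "cw_potential b (g0 + \<delta>) \<le> cw_potential b \<bar>g\<bar>"
        using mono(2)[of "g0 + \<delta>" "\<bar>g\<bar>"] far \<delta>(1) by (cases "g0 + \<delta> = \<bar>g\<bar>") (auto simp: g0_def)
      then show ?thesis by (auto simp: \<eta>_def)
    next
      case False
      then have "cw_potential b (g0 - \<delta>) \<le> cw_potential b \<bar>g\<bar>" "g0 - \<delta> \<ge> 0"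
        using mono(1)[of "\<bar>g\<bar>" "g0 - \<delta>"] far \<delta>(1) by (cases "g0 - \<delta> = \<bar>g\<bar>"; auto simp: g0_def)+
      then show ?thesis by (auto simp: \<eta>_def)
    qed
    then show ?thesis by (simp add: cw_potential_abs)
  qed
  ultimately have "\<eta> > 0 \<and> (\<forall>g. \<epsilon> \<le> \<bar>h g - (cw_mag \<beta>)\<^sup>2\<bar> \<longrightarrow>
      cw_potential b g0 + \<eta> \<le> cw_potential b g)"
    by (simp add: h0)
  then show ?thesis unfolding h_def g0_def by (rule exI)
qed

text \<open>Where \<open>h\<close> is below \<open>\<epsilon>\<close> the quotient is at most
  \<open>\<epsilon>\<close>. Elsewhere \<open>K\<close> exceeds \<open>K c\<close> by
  \<open>\<eta>\<close>, while a neighbourhood of \<open>c\<close>, on which \<open>K\<close> stays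
  below \<open>K c + \<eta> / 2\<close>, already bounds the denominator from below. The gap of
  \<open>\<eta> / 2\<close> makes the remaining quotient exponentially small.\<close>

lemma laplace_concentration:
  fixes K h :: "real \<Rightarrow> real" and c :: real
  assumes cont: "isCont K c"
    and [measurable]: "h \<in> borel_measurable borel"
    and int: "\<And>n. n \<ge> 1 \<Longrightarrow> integrable lborel (\<lambda>g. exp (- real n * K g))"
    and h: "\<And>g. 0 \<le> h g" "\<And>g. h g \<le> 1"
    and sep: "\<And>\<epsilon>. \<epsilon> > 0 \<Longrightarrow> \<exists>\<eta>>0. \<forall>g. \<epsilon> \<le> h g \<longrightarrow> K c + \<eta> \<le> K g"
  shows "(\<lambda>n. (\<integral>g. exp (- real n * K g) * h g \<partial>lborel) / (\<integral>g. exp (- real n * K g) \<partial>lborel))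
    \<longlonglongrightarrow> 0"
proof (rule LIMSEQ_I)
  fix r :: real assume "r > 0"
  define I where "I n = (\<integral>g. exp (- real n * K g) \<partial>lborel)" for n
  define J where "J n = (\<integral>g. exp (- real n * K g) * h g \<partial>lborel)" for n
  define \<epsilon> where "\<epsilon> = r / 2"
  have \<epsilon>: "\<epsilon> > 0" using \<open>r > 0\<close> by (simp add: \<epsilon>_def)
  obtain \<eta> where \<eta>: "\<eta> > 0" "\<And>g. \<epsilon> \<le> h g \<Longrightarrow> K c + \<eta> \<le> K g"
    using sep[OF \<epsilon>] by blast
  obtain \<delta> where \<delta>: "\<delta> > 0" "\<And>g. \<bar>g - c\<bar> < \<delta> \<Longrightarrow> \<bar>K g - K c\<bar> < \<eta> / 2"
    using cont \<eta>(1) unfolding continuous_at_eps_delta by (metis dist_real_def half_gt_zero)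
  \<comment> \<open>The constant left over when the bound for the bad region is divided by that for
    the window: \<open>2 * \<delta>\<close> is the length of the window, \<open>I 1\<close> comes
    from one retained factor \<open>exp (- K g)\<close>, and \<open>exp (K c + \<eta>)\<close>
    compensates for using only \<open>n - 1\<close> of the factors.\<close>
  define C where "C = I 1 * exp (K c + \<eta>) / (2 * \<delta>)"
  have intJ: "integrable lborel (\<lambda>g. exp (- real n * K g) * h g)" if "n \<ge> 1" for n
    by (rule Bochner_Integration.integrable_bound[OF int[OF that]])
       (use borel_measurable_integrable[OF int[OF that]] h in \<open>auto simp: abs_mult mult_left_le\<close>)
  have I_low: "2 * \<delta> * exp (- real n * (K c + \<eta> / 2)) \<le> I n" if "n \<ge> 1" for n
  proof -
    have "2 * \<delta> * exp (- real n * (K c + \<eta> / 2)) =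
      (\<integral>g. exp (- real n * (K c + \<eta> / 2)) * indicator {c - \<delta><..<c + \<delta>} g \<partial>lborel)"
      using \<delta>(1) by simp
    also have "\<dots> \<le> I n"
      unfolding I_def
    proof (rule integral_mono[OF _ int[OF that]])
      fix g
      show "exp (- real n * (K c + \<eta> / 2)) * indicator {c - \<delta><..<c + \<delta>} g \<le> exp (- real n * K g)"
      proof (cases "\<bar>g - c\<bar> < \<delta>")
        case True
        then have "K g \<le> K c + \<eta> / 2" using \<delta>(2)[of g] by linarith
        then have "exp (- real n * (K c + \<eta> / 2)) \<le> exp (- real n * K g)"
          by (simp add: mult_left_mono)
        then show ?thesis by (simp add: indicator_def)
      next
        case False
        then have "g \<notin> {c - \<delta><..<c + \<delta>}" by auto
        then show ?thesis by simp
      qed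
    qed (use \<delta>(1) in \<open>simp add: integrable_real_mult_indicator\<close>)
    finally show ?thesis .
  qed
  have I_pos: "I n > 0" if "n \<ge> 1" for n
    using I_low[OF that] \<delta>(1) by (meson exp_gt_zero less_le_trans mult_pos_pos zero_less_numeral)
  have J_up: "J n \<le> \<epsilon> * I n + exp (- (real n - 1) * (K c + \<eta>)) * I 1" if "n \<ge> 1" for n
  proof -
    have "J n \<le> (\<integral>g. \<epsilon> * exp (- real n * K g) +
        exp (- (real n - 1) * (K c + \<eta>)) * exp (- real 1 * K g) \<partial>lborel)"
      unfolding J_def
    proof (rule integral_mono[OF intJ[OF that]])
      fix g
      show "exp (- real n * K g) * h g \<le> \<epsilon> * exp (- real n * K g) +
        exp (- (real n - 1) * (K c + \<eta>)) * exp (- real 1 * K g)"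
      proof (cases "\<epsilon> \<le> h g")
        case True
        have "exp (- real n * K g) * h g \<le> exp (- real n * K g)"
          using h by (simp add: mult_left_le)
        \<comment> \<open>One factor is set aside to keep the bound integrable; the other
          \<open>n - 1\<close> factors are bounded by a constant.\<close>
        also have "\<dots> = exp (- (real n - 1) * K g) * exp (- real 1 * K g)"
          by (simp add: exp_add[symmetric] algebra_simps)
        also have "\<dots> \<le> exp (- (real n - 1) * (K c + \<eta>)) * exp (- real 1 * K g)"
        proof -
          have "(real n - 1) * (K c + \<eta>) \<le> (real n - 1) * K g"
            using \<eta>(2)[OF True] that by (intro mult_left_mono) auto
          then show ?thesis by (simp add: algebra_simps)
        qed
        finally show ?thesis using \<epsilon> by (smt (verit) exp_gt_zero mult_pos_pos)
      next
        case False
        then have "exp (- real n * K g) * h g \<le> \<epsilon> * exp (- real n * K g)" by simp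
        then show ?thesis by (smt (verit) exp_gt_zero mult_pos_pos)
      qed
    qed (use int[OF that] int[of 1] in simp)
    also have "\<dots> = \<epsilon> * I n + exp (- (real n - 1) * (K c + \<eta>)) * I 1"
      unfolding I_def using int[OF that] int[of 1] by simp
    finally show ?thesis .
  qed
  have main: "J n / I n \<le> \<epsilon> + C * exp (- (\<eta> / 2) * real n)" if "n \<ge> 1" for n
  proof -
    have "exp (- (real n - 1) * (K c + \<eta>)) * I 1 =
        C * exp (- (\<eta> / 2) * real n) * (2 * \<delta> * exp (- real n * (K c + \<eta> / 2)))"
    proof -
      have "exp (- (real n - 1) * (K c + \<eta>)) =
        exp (K c + \<eta>) * exp (- (\<eta> / 2) * real n) * exp (- real n * (K c + \<eta> / 2))"
        by (simp add: exp_add[symmetric] algebra_simps)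
      then show ?thesis using \<delta>(1) by (simp add: C_def)
    qed
    also have "\<dots> \<le> C * exp (- (\<eta> / 2) * real n) * I n"
      using I_low[OF that] I_pos[of 1] \<delta>(1) by (intro mult_left_mono) (auto simp: C_def)
    finally have "J n \<le> (\<epsilon> + C * exp (- (\<eta> / 2) * real n)) * I n"
      using J_up[OF that] by (simp add: algebra_simps)
    then show ?thesis using I_pos[OF that] by (simp add: field_simps)
  qed
  have "(\<lambda>n. C * exp (- (\<eta> / 2) * real n)) \<longlonglongrightarrow> C * 0"
  proof (intro tendsto_intros)
    have "(\<lambda>n. exp (- (\<eta> / 2)) ^ n) \<longlonglongrightarrow> 0"
      using \<eta>(1) by (intro LIMSEQ_realpow_zero) auto
    then show "(\<lambda>n. exp (- (\<eta> / 2) * real n)) \<longlonglongrightarrow> 0"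
      unfolding exp_of_nat2_mult .
  qed
  then have "eventually (\<lambda>n. C * exp (- (\<eta> / 2) * real n) < r / 2) sequentially"
    using \<open>r > 0\<close> by (intro order_tendstoD) auto
  then have "eventually (\<lambda>n. norm (J n / I n - 0) < r) sequentially"
    using eventually_ge_at_top[of 1]
  proof eventually_elim
    case (elim n)
    have "J n / I n \<ge> 0"
      using I_pos[of n] elim h by (auto simp: J_def intro!: divide_nonneg_pos integral_nonneg)
    then show ?case using main[of n] elim by (simp add: \<epsilon>_def)
  qed
  then show "\<exists>no. \<forall>n\<ge>no. norm ((\<integral>g. exp (- real n * K g) * h g \<partial>lborel) /
      (\<integral>g. exp (- real n * K g) \<partial>lborel) - 0) < r"
    unfolding I_def J_def eventually_sequentially .
qed

subsection \<open>Product laws on spin configurations\<close>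

lemma spins_Suc: "spins (Suc n) = (\<lambda>(z, s). z(n := s)) ` (spins n \<times> {-1, 1})"
proof (intro equalityI subsetI)
  fix z assume z: "z \<in> spins (Suc n)"
  then have "z = (z(n := 0))(n := z n)" "z(n := 0) \<in> spins n" "z n \<in> {-1, 1}"
    by (auto simp: spins_def)
  then show "z \<in> (\<lambda>(z, s). z(n := s)) ` (spins n \<times> {-1, 1})"
    by (intro image_eqI[where x = "(z(n := 0), z n)"]) auto
next
  fix z assume "z \<in> (\<lambda>(z, s). z(n := s)) ` (spins n \<times> {-1, 1})"
  then show "z \<in> spins (Suc n)" by (auto simp: spins_def less_Suc_eq)
qed

lemma spins_0: "spins 0 = {\<lambda>_. 0}"
  by (auto simp: spins_def)

lemma finite_spins: "finite (spins n)"
  by (induction n) (auto simp: spins_0 spins_Suc)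

lemma spins_nonempty: "spins n \<noteq> {}"
  by (induction n) (auto simp: spins_0 spins_Suc)

lemma spins_cases: "z \<in> spins n \<Longrightarrow> i < n \<Longrightarrow> z i = -1 \<or> z i = 1"
  by (simp add: spins_def)

lemma sum_prod_spins:
  fixes F :: "nat \<Rightarrow> real \<Rightarrow> 'a :: comm_semiring_1"
  shows "(\<Sum>z\<in>spins n. \<Prod>i<n. F i (z i)) = (\<Prod>i<n. F i (-1) + F i 1)"
proof (induction n)
  case 0
  show ?case by (simp add: spins_0)
next
  case (Suc n)
  have inj: "inj_on (\<lambda>(z, s). z(n := s)) (spins n \<times> {-1, 1})"
  proof (rule inj_onI, clarify)
    fix z s z' s' assume *: "z \<in> spins n" "z' \<in> spins n" "z(n := s) = z'(n := s')"
    \<comment> \<open>Both configurations vanish at index \<open>n\<close>, so resetting that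
      coordinate recovers them.\<close>
    have "z n = z' n" using * by (simp add: spins_def)
    then show "z = z' \<and> s = s'" using *(3) by (metis fun_upd_same fun_upd_triv fun_upd_upd)
  qed
  have "(\<Sum>z\<in>spins (Suc n). \<Prod>i<Suc n. F i (z i)) =
    (\<Sum>(z, s)\<in>spins n \<times> {-1, 1}. (\<Prod>i<n. F i (z i)) * F n s)"
    unfolding spins_Suc sum.reindex[OF inj] by (auto intro!: sum.cong prod.cong)
  also have "\<dots> = (\<Sum>z\<in>spins n. \<Sum>s\<in>{-1, 1}. (\<Prod>i<n. F i (z i)) * F n s)"
    by (rule sum.cartesian_product[symmetric])
  also have "\<dots> = (\<Sum>z\<in>spins n. \<Prod>i<n. F i (z i)) * (F n (-1) + F n 1)"
    by (simp add: sum_distrib_right distrib_left sum.distrib)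
  finally show ?case by (simp add: Suc)
qed

text \<open>The i.i.d. law of spins with mean \<open>\<mu>\<close>.\<close>

definition tilt :: "real \<Rightarrow> nat \<Rightarrow> (nat \<Rightarrow> real) \<Rightarrow> real" where
  "tilt \<mu> n z = (\<Prod>i<n. (1 + \<mu> * z i) / 2)"

text \<open>Independence: each coordinate takes -1 and 1 with probabilities
  \<open>(1 - \<mu>) / 2\<close> and \<open>(1 + \<mu>) / 2\<close>, so the expectation of a product
  factorizes. The general ring covers real moments and complex characteristic functions
  alike.\<close>

lemma sum_tilt_prod:
  fixes F :: "nat \<Rightarrow> real \<Rightarrow> 'a :: {comm_ring_1, real_algebra_1}"
  shows "(\<Sum>z\<in>spins n. of_real (tilt \<mu> n z) * (\<Prod>i<n. F i (z i))) =
    (\<Prod>i<n. of_real ((1 - \<mu>) / 2) * F i (-1) + of_real ((1 + \<mu>) / 2) * F i 1)"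
  using sum_prod_spins[of "\<lambda>i s. of_real ((1 + \<mu> * s) / 2) * F i s" n]
  unfolding tilt_def of_real_prod prod.distrib by simp

lemma tilt_nonneg:
  assumes "\<bar>\<mu>\<bar> \<le> 1" "z \<in> spins n"
  shows "tilt \<mu> n z \<ge> 0"
  unfolding tilt_def
proof (rule prod_nonneg, safe)
  fix i assume "i < n"
  then show "0 \<le> (1 + \<mu> * z i) / 2" using spins_cases[OF assms(2)] assms(1) by force
qed

lemma sum_tilt: "(\<Sum>z\<in>spins n. tilt \<mu> n z) = 1"
  using sum_tilt_prod[of \<mu> n "\<lambda>_ _. 1 :: real"] by (simp add: add_divide_distrib[symmetric])

text \<open>The variance of a sum of \<open>n\<close> independent spins: off-diagonal covariances
  vanish and each diagonal one is \<open>1 - \<mu>\<^sup>2\<close>.\<close>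

lemma tilt_variance:
  "(\<Sum>z\<in>spins n. tilt \<mu> n z * (\<Sum>i<n. z i - \<mu>)\<^sup>2) = real n * (1 - \<mu>\<^sup>2)"
proof -
  have cov: "(\<Sum>z\<in>spins n. tilt \<mu> n z * ((z i - \<mu>) * (z j - \<mu>))) = (if i = j then 1 - \<mu>\<^sup>2 else 0)"
    if "i < n" "j < n" for i j
  proof -
    \<comment> \<open>A product of one-coordinate functions equal to
      \<open>(z i - \<mu>) * (z j - \<mu>)\<close>; when \<open>i = j\<close> both factors fall on
      the same coordinate and give the square.\<close>
    define F where "F k s = (if k = i then s - \<mu> else 1) * (if k = j then s - \<mu> else 1)" for k and s :: real
    have "(\<Prod>k<n. F k (z k)) = (z i - \<mu>) * (z j - \<mu>)" for z
      using that by (simp add: F_def prod.distrib prod.delta)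
    then have "(\<Sum>z\<in>spins n. tilt \<mu> n z * ((z i - \<mu>) * (z j - \<mu>))) =
      (\<Prod>k<n. (1 - \<mu>) / 2 * F k (-1) + (1 + \<mu>) / 2 * F k 1)"
      using sum_tilt_prod[of \<mu> n F] by simp
    also have "\<dots> = (if i = j then 1 - \<mu>\<^sup>2 else 0)"
    proof (cases "i = j")
      case True
      have "(\<Prod>k<n. (1 - \<mu>) / 2 * F k (-1) + (1 + \<mu>) / 2 * F k 1) = (\<Prod>k<n. if k = i then 1 - \<mu>\<^sup>2 else 1)"
        using True by (intro prod.cong) (auto simp: F_def field_simps power2_eq_square)
      then show ?thesis using True that by simp
    next
      case False
      have "(1 - \<mu>) / 2 * F i (-1) + (1 + \<mu>) / 2 * F i 1 = 0"
        using False by (simp add: F_def field_simps)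
      then show ?thesis using False that by (auto intro!: prod_zero)
    qed
    finally show ?thesis .
  qed
  have "(\<Sum>z\<in>spins n. tilt \<mu> n z * (\<Sum>i<n. z i - \<mu>)\<^sup>2) =
    (\<Sum>z\<in>spins n. \<Sum>i<n. \<Sum>j<n. tilt \<mu> n z * ((z i - \<mu>) * (z j - \<mu>)))"
    unfolding power2_eq_square sum_product by (simp add: sum_distrib_left)
  also have "\<dots> = (\<Sum>i<n. \<Sum>j<n. \<Sum>z\<in>spins n. tilt \<mu> n z * ((z i - \<mu>) * (z j - \<mu>)))"
    by (subst sum.swap, rule sum.cong[OF refl], rule sum.swap)
  also have "\<dots> = (\<Sum>i<n. \<Sum>j<n. if i = j then 1 - \<mu>\<^sup>2 else 0)"
    by (intro sum.cong refl cov) auto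
  finally show ?thesis by simp
qed

text \<open>The exponential-family form of the product law:
  \<open>cosh u + sinh u * s = exp (u * s)\<close> for a spin \<open>s\<close>. The spins then enter
  only through their sum, linearly in the exponent.\<close>

lemma tilt_tanh:
  assumes "z \<in> spins n"
  shows "tilt (tanh u) n z = exp (u * (\<Sum>i<n. z i)) / (2 * cosh u) ^ n"
proof -
  have "(1 + tanh u * z i) / 2 = exp (u * z i) / (2 * cosh u)" if "i < n" for i
  proof -
    have "cosh u + sinh u * z i = exp (u * z i)"
      using spins_cases[OF assms that] cosh_plus_sinh[of u] cosh_minus_sinh[of u] by auto
    moreover have "1 + tanh u * z i = (cosh u + sinh u * z i) / cosh u"
      by (simp add: tanh_def add_divide_distrib)
    ultimately show ?thesis by simp
  qed
  then show ?thesis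
    by (simp add: tilt_def prod_dividef sum_distrib_left exp_sum)
qed

subsection \<open>The Curie--Weiss law as a mixture of product laws\<close>

abbreviation cw_prob :: "real \<Rightarrow> nat \<Rightarrow> (nat \<Rightarrow> real) \<Rightarrow> real" where
  "cw_prob \<beta> n z \<equiv> ising_weight \<beta> (Q_CW n) n z / partition_fun \<beta> (Q_CW n) n"

text \<open>Completing the square turns the integrand into a multiple of the normal density with
  mean \<open>c / n\<close> and variance \<open>1 / n\<close>. Read from right to left, this
  linearizes the square of the spin sum.\<close>

lemma gaussian_linear_integral:
  fixes c :: real
  assumes "n > 0"
  shows "integrable lborel (\<lambda>g. exp (- real n * g\<^sup>2 / 2 + c * g))"
    and "(\<integral>g. exp (- real n * g\<^sup>2 / 2 + c * g) \<partial>lborel) = sqrt (2 * pi / real n) * exp (c\<^sup>2 / (2 * real n))"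
proof -
  define k where "k = sqrt (2 * pi / real n) * exp (c\<^sup>2 / (2 * real n))"
  have eq: "exp (- real n * g\<^sup>2 / 2 + c * g) = k * normal_density (c / real n) (1 / sqrt (real n)) g" for g
  proof -
    have "- real n * g\<^sup>2 / 2 + c * g = c\<^sup>2 / (2 * real n) + (- real n * (g - c / real n)\<^sup>2 / 2)"
      using assms by (simp add: field_simps power2_eq_square)
    then show ?thesis
      using assms by (simp add: k_def normal_density_def exp_add[symmetric] power_divide field_simps)
  qed
  show "integrable lborel (\<lambda>g. exp (- real n * g\<^sup>2 / 2 + c * g))"
    unfolding eq using assms by (intro integrable_mult_right) auto
  show "(\<integral>g. exp (- real n * g\<^sup>2 / 2 + c * g) \<partial>lborel) = sqrt (2 * pi / real n) * exp (c\<^sup>2 / (2 * real n))"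
    unfolding eq using assms by (simp add: k_def)
qed

text \<open>The quadratic form is the full square of the spin sum over \<open>n\<close>, less the
  diagonal terms. As each spin squares to 1, these contribute the constant 1, hence a factor that
  normalization removes.\<close>

lemma ising_weight_Q_CW:
  assumes "z \<in> spins n" "n > 0"
  shows "ising_weight \<beta> (Q_CW n) n z = exp (- \<beta> / 2) * exp (\<beta> * (\<Sum>i<n. z i)\<^sup>2 / (2 * real n))"
proof -
  have sq: "z i * z i = 1" if "i < n" for i using spins_cases[OF assms(1) that] by auto
  have "(\<Sum>i<n. \<Sum>j<n. z i * Q_CW n i j * z j) =
    (\<Sum>i<n. \<Sum>j<n. z i * z j / real n - (if i = j then z i * z i / real n else 0))"
    by (intro sum.cong) (auto simp: Q_CW_def)
  also have "\<dots> = (\<Sum>i<n. z i)\<^sup>2 / real n - (\<Sum>i<n. z i * z i / real n)"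
    by (simp add: sum_subtractf power2_eq_square sum_product sum_divide_distrib)
  also have "(\<Sum>i<n. z i * z i / real n) = 1"
    using sq assms(2) by simp
  finally have "(\<Sum>i<n. \<Sum>j<n. z i * Q_CW n i j * z j) = (\<Sum>i<n. z i)\<^sup>2 / real n - 1" .
  then show ?thesis
    unfolding ising_weight_def exp_add[symmetric] by (simp add: right_diff_distrib)
qed

text \<open>The power of \<open>cosh (b * g)\<close> in the exponential of the potential cancels the
  normalization of the product law, leaving a Gaussian integrand with a linear term.\<close>

lemma exp_cw_potential_tilt:
  assumes "z \<in> spins n"
  shows "exp (- real n * cw_potential b g) * tilt (tanh (b * g)) n z =
    exp (- real n * g\<^sup>2 / 2 + b * (\<Sum>i<n. z i) * g) / 2 ^ n"
proof -
  have "exp (- real n * cw_potential b g) = exp (- real n * g\<^sup>2 / 2) * exp (real n * ln (cosh (b * g)))"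
    by (simp add: cw_potential_def exp_add[symmetric] algebra_simps)
  also have "exp (real n * ln (cosh (b * g))) = cosh (b * g) ^ n"
    by (simp add: exp_of_nat_mult)
  finally show ?thesis
    unfolding tilt_tanh[OF assms] exp_add by (simp add: power_mult_distrib mult_ac)
qed

lemma integrable_cw_potential_tilt:
  assumes "z \<in> spins n" "n > 0"
  shows "integrable lborel (\<lambda>g. exp (- real n * cw_potential b g) * tilt (tanh (b * g)) n z)"
  unfolding exp_cw_potential_tilt[OF assms(1)]
  using gaussian_linear_integral(1)[OF assms(2)] by simp

lemma exp_cw_potential_eq_sum:
  "exp (- real n * cw_potential b g) =
    (\<Sum>z\<in>spins n. exp (- real n * cw_potential b g) * tilt (tanh (b * g)) n z)"
  by (simp add: sum_distrib_left[symmetric] sum_tilt)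

lemma integrable_exp_cw_potential:
  assumes "n > 0"
  shows "integrable lborel (\<lambda>g. exp (- real n * cw_potential b g))"
  by (subst exp_cw_potential_eq_sum)
     (intro Bochner_Integration.integrable_sum integrable_cw_potential_tilt assms)

text \<open>Up to a constant \<open>k\<close> independent of the configuration, the Ising weight is
  the Gaussian integral of the product weight. Summing over configurations gives the partition
  function with the same \<open>k\<close>, which cancels.\<close>

lemma cw_prob_mixture:
  assumes "\<beta> \<ge> 0" "n > 0" "z \<in> spins n"
  defines "b \<equiv> sqrt \<beta>"
  shows "cw_prob \<beta> n z = (\<integral>g. exp (- real n * cw_potential b g) * tilt (tanh (b * g)) n z \<partial>lborel) /
    (\<integral>g. exp (- real n * cw_potential b g) \<partial>lborel)"
proof -
  \<comment> \<open>Collects the diagonal factor \<open>exp (- \<beta> / 2)\<close>, the Gaussian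
    normalization, and the \<open>2 ^ n\<close> of the product law.\<close>
  define k where "k = exp (- \<beta> / 2) / (sqrt (2 * pi / real n) / 2 ^ n)"
  have k: "k > 0" using assms by (simp add: k_def)
  have w: "ising_weight \<beta> (Q_CW n) n z =
    k * (\<integral>g. exp (- real n * cw_potential b g) * tilt (tanh (b * g)) n z \<partial>lborel)"
    if "z \<in> spins n" for z
    unfolding exp_cw_potential_tilt[OF that] ising_weight_Q_CW[OF that assms(2)]
    using assms gaussian_linear_integral[OF assms(2), of "b * (\<Sum>i<n. z i)"]
    by (simp add: k_def power_mult_distrib)
  have "partition_fun \<beta> (Q_CW n) n =
    k * (\<Sum>z\<in>spins n. \<integral>g. exp (- real n * cw_potential b g) * tilt (tanh (b * g)) n z \<partial>lborel)"
    unfolding partition_fun_def by (simp add: w sum_distrib_left)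
  also have "(\<Sum>z\<in>spins n. \<integral>g. exp (- real n * cw_potential b g) * tilt (tanh (b * g)) n z \<partial>lborel) =
    (\<integral>g. exp (- real n * cw_potential b g) \<partial>lborel)"
    by (subst exp_cw_potential_eq_sum, rule Bochner_Integration.integral_sum[symmetric])
       (use integrable_cw_potential_tilt assms(2) in blast)
  finally show ?thesis using k w[OF assms(3)] by simp
qed

text \<open>The part of the integral belonging to a single configuration is an explicit positive
  Gaussian integral, and it is a lower bound because a product probability is at most 1.\<close>

lemma integral_exp_cw_potential_pos:
  assumes "n > 0"
  shows "(\<integral>g. exp (- real n * cw_potential b g) \<partial>lborel) > 0"
proof -
  obtain z where z: "z \<in> spins n" using spins_nonempty by blast
  have "0 < (\<integral>g. exp (- real n * cw_potential b g) * tilt (tanh (b * g)) n z \<partial>lborel)"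
    unfolding exp_cw_potential_tilt[OF z] using gaussian_linear_integral[OF assms] assms by simp
  also have "\<dots> \<le> (\<integral>g. exp (- real n * cw_potential b g) \<partial>lborel)"
  proof (rule integral_mono[OF integrable_cw_potential_tilt[OF z assms] integrable_exp_cw_potential[OF assms]])
    fix g
    have "tilt (tanh (b * g)) n z \<le> (\<Sum>z\<in>spins n. tilt (tanh (b * g)) n z)"
      using z tanh_real_bounds[of "b * g"]
      by (intro member_le_sum finite_spins tilt_nonneg) auto
    then show "exp (- real n * cw_potential b g) * tilt (tanh (b * g)) n z \<le> exp (- real n * cw_potential b g)"
      by (simp add: sum_tilt mult_left_le)
  qed
  finally show ?thesis .
qed

text \<open>The mean distance of \<open>\<mu>\<^sup>2\<close> from \<open>m\<^sup>2\<close> under the mixing law.\<close>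

definition mix_dev :: "real \<Rightarrow> nat \<Rightarrow> real" where
  "mix_dev \<beta> n =
    (\<integral>g. exp (- real n * cw_potential (sqrt \<beta>) g) * \<bar>(tanh (sqrt \<beta> * g))\<^sup>2 - (cw_mag \<beta>)\<^sup>2\<bar> \<partial>lborel) /
    (\<integral>g. exp (- real n * cw_potential (sqrt \<beta>) g) \<partial>lborel)"

lemma abs_diff_squares_le_1:
  fixes x y :: real
  assumes "\<bar>x\<bar> \<le> 1" "\<bar>y\<bar> \<le> 1"
  shows "\<bar>x\<^sup>2 - y\<^sup>2\<bar> \<le> 1"
proof -
  have "x\<^sup>2 \<le> 1" "y\<^sup>2 \<le> 1" using assms by (simp_all add: abs_square_le_1)
  then show ?thesis using zero_le_power2[of x] zero_le_power2[of y] by linarith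
qed

lemma abs_tanh_le_1: "\<bar>tanh (x :: real)\<bar> \<le> 1"
  using tanh_real_bounds[of x] by auto

lemma mix_dev_tendsto_0:
  assumes "\<beta> \<ge> 0"
  shows "mix_dev \<beta> \<longlonglongrightarrow> 0"
  unfolding mix_dev_def
proof (rule laplace_concentration[where c = "sqrt \<beta> * cw_mag \<beta>"])
  show "isCont (cw_potential (sqrt \<beta>)) (sqrt \<beta> * cw_mag \<beta>)"
    using continuous_on_cw_potential[of UNIV] by (simp add: continuous_on_eq_continuous_at)
  show "(\<lambda>g. \<bar>(tanh (sqrt \<beta> * g))\<^sup>2 - (cw_mag \<beta>)\<^sup>2\<bar>) \<in> borel_measurable borel"
    by (intro borel_measurable_continuous_onI continuous_intros) auto
  show "\<bar>(tanh (sqrt \<beta> * g))\<^sup>2 - (cw_mag \<beta>)\<^sup>2\<bar> \<le> 1" for g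
    using cw_mag_characterization[OF assms] by (intro abs_diff_squares_le_1 abs_tanh_le_1) auto
qed (use integrable_exp_cw_potential cw_potential_separation assms in auto)

text \<open>The transfer principle: a bound under every product law, affine in the distance of
  \<open>\<mu>\<^sup>2\<close> from its limit, is averaged over the mixing density. It is applied to
  a real function for the sample mean and to a complex one for characteristic functions.\<close>

lemma cw_expectation_bound:
  fixes f :: "(nat \<Rightarrow> real) \<Rightarrow> 'a :: {banach, second_countable_topology}"
  assumes "\<beta> \<ge> 0" "n > 0"
    and bound: "\<And>\<mu>. \<bar>\<mu>\<bar> \<le> 1 \<Longrightarrow>
      norm (\<Sum>z\<in>spins n. tilt \<mu> n z *\<^sub>R f z) \<le> C + D * \<bar>\<mu>\<^sup>2 - (cw_mag \<beta>)\<^sup>2\<bar>"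
  shows "norm (\<Sum>z\<in>spins n. cw_prob \<beta> n z *\<^sub>R f z) \<le> C + D * mix_dev \<beta> n"
proof -
  define b where "b = sqrt \<beta>"
  define p where "p g = exp (- real n * cw_potential b g)" for g
  define I where "I = (\<integral>g. p g \<partial>lborel)"
  define h where "h g = \<bar>(tanh (b * g))\<^sup>2 - (cw_mag \<beta>)\<^sup>2\<bar>" for g
  have I: "I > 0" unfolding I_def p_def by (rule integral_exp_cw_potential_pos[OF assms(2)])
  have int_p: "integrable lborel p"
    unfolding p_def by (rule integrable_exp_cw_potential[OF assms(2)])
  have h_nonneg: "h g \<ge> 0" for g by (simp add: h_def)
  have h_le: "h g \<le> 1" for g
    unfolding h_def
    using cw_mag_characterization[OF assms(1)] by (intro abs_diff_squares_le_1 abs_tanh_le_1) auto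
  have [measurable]: "h \<in> borel_measurable borel"
    unfolding h_def by (intro borel_measurable_continuous_onI continuous_intros) auto
  have int_ph: "integrable lborel (\<lambda>g. p g * h g)"
    by (rule Bochner_Integration.integrable_bound[OF int_p])
       (use borel_measurable_integrable[OF int_p] h_nonneg h_le in \<open>auto simp: abs_mult mult_left_le\<close>)
  have int_z: "integrable lborel (\<lambda>g. (p g * tilt (tanh (b * g)) n z) *\<^sub>R f z)" if "z \<in> spins n" for z
    unfolding p_def by (intro integrable_scaleR_left integrable_cw_potential_tilt that assms)
  have "(\<Sum>z\<in>spins n. cw_prob \<beta> n z *\<^sub>R f z) =
    (\<Sum>z\<in>spins n. (1 / I) *\<^sub>R (\<integral>g. (p g * tilt (tanh (b * g)) n z) *\<^sub>R f z \<partial>lborel))"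
    using integrable_cw_potential_tilt[OF _ assms(2)]
    by (intro sum.cong refl) (simp add: cw_prob_mixture assms b_def p_def I_def)
  also have "\<dots> = (1 / I) *\<^sub>R (\<integral>g. (\<Sum>z\<in>spins n. (p g * tilt (tanh (b * g)) n z) *\<^sub>R f z) \<partial>lborel)"
    unfolding scaleR_sum_right[symmetric]
    by (subst Bochner_Integration.integral_sum) (auto intro: int_z)
  finally have eq: "(\<Sum>z\<in>spins n. cw_prob \<beta> n z *\<^sub>R f z) = \<dots>" .
  have "norm (\<integral>g. (\<Sum>z\<in>spins n. (p g * tilt (tanh (b * g)) n z) *\<^sub>R f z) \<partial>lborel) \<le>
    (\<integral>g. norm (\<Sum>z\<in>spins n. (p g * tilt (tanh (b * g)) n z) *\<^sub>R f z) \<partial>lborel)"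
    by (rule integral_norm_bound)
  also have "\<dots> \<le> (\<integral>g. C * p g + D * (p g * h g) \<partial>lborel)"
  proof (rule integral_mono)
    fix g
    have "norm (\<Sum>z\<in>spins n. (p g * tilt (tanh (b * g)) n z) *\<^sub>R f z) =
      p g * norm (\<Sum>z\<in>spins n. tilt (tanh (b * g)) n z *\<^sub>R f z)"
      unfolding scaleR_scaleR[symmetric] scaleR_sum_right[symmetric] by (simp add: p_def)
    also have "\<dots> \<le> p g * (C + D * h g)"
      unfolding h_def by (intro mult_left_mono bound abs_tanh_le_1) (simp add: p_def)
    finally show "norm (\<Sum>z\<in>spins n. (p g * tilt (tanh (b * g)) n z) *\<^sub>R f z) \<le> C * p g + D * (p g * h g)"
      by (simp add: algebra_simps)
  qed (use int_z int_p int_ph in auto)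
  also have "\<dots> = C * I + D * (\<integral>g. p g * h g \<partial>lborel)"
    using int_p int_ph by (simp add: I_def)
  finally have "norm (\<integral>g. (\<Sum>z\<in>spins n. (p g * tilt (tanh (b * g)) n z) *\<^sub>R f z) \<partial>lborel) / I \<le>
    (C * I + D * (\<integral>g. p g * h g \<partial>lborel)) / I"
    using I by (intro divide_right_mono) auto
  also have "\<dots> = C + D * mix_dev \<beta> n"
    using I by (simp add: mix_dev_def p_def h_def I_def b_def add_divide_distrib)
  finally show ?thesis unfolding eq using I by simp
qed

section \<open>Concentration of the squared sample mean\<close>

lemma abs_sample_mean_le_1:
  assumes "n > 0" "x \<in> spins n"
  shows "\<bar>sample_mean n x\<bar> \<le> 1"
proof -
  have "\<bar>\<Sum>i<n. x i\<bar> \<le> (\<Sum>i<n. 1)"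
    by (rule order.trans[OF sum_abs sum_mono]) (use spins_cases[OF assms(2)] in force)
  then show ?thesis using assms by (simp add: sample_mean_def abs_divide)
qed

text \<open>Under the product law of mean \<open>\<mu>\<close> the sample mean has variance
  \<open>(1 - \<mu>\<^sup>2) / n\<close>, so its square is close to \<open>\<mu>\<^sup>2\<close>,
  and mixing does the rest. Squares are compared because for \<open>\<beta> > 1\<close> the mean
  settles near \<open>m\<close> or \<open>- m\<close>.\<close>

lemma sample_mean_sq_concentration:
  assumes "\<beta> \<ge> 0" "n > 0"
  shows "(\<Sum>x\<in>spins n. cw_prob \<beta> n x * \<bar>(sample_mean n x)\<^sup>2 - (cw_mag \<beta>)\<^sup>2\<bar>) \<le>
    2 / sqrt (real n) + mix_dev \<beta> n"
proof -
  define m where "m = cw_mag \<beta>"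
  have "norm (\<Sum>x\<in>spins n. cw_prob \<beta> n x *\<^sub>R \<bar>(sample_mean n x)\<^sup>2 - m\<^sup>2\<bar>) \<le>
    2 / sqrt (real n) + 1 * mix_dev \<beta> n"
  proof (rule cw_expectation_bound[OF assms])
    fix \<mu> :: real assume \<mu>: "\<bar>\<mu>\<bar> \<le> 1"
    define q where "q = sqrt (real n)"
    have q: "q > 0" "q * q = real n" using assms by (auto simp: q_def)
    have pt: "\<bar>(sample_mean n x)\<^sup>2 - m\<^sup>2\<bar> \<le> \<bar>\<mu>\<^sup>2 - m\<^sup>2\<bar> + 1 / q + (\<Sum>i<n. x i - \<mu>)\<^sup>2 / (q * real n)"
      if "x \<in> spins n" for x
    proof -
      define a where "a = sample_mean n x"
      have a: "\<bar>a\<bar> \<le> 1" unfolding a_def by (rule abs_sample_mean_le_1[OF assms(2) that])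
      define d where "d = \<bar>a - \<mu>\<bar>"
      have "\<bar>a\<^sup>2 - \<mu>\<^sup>2\<bar> = d * \<bar>a + \<mu>\<bar>"
        by (simp add: d_def abs_mult[symmetric] power2_eq_square algebra_simps)
      also have "\<dots> \<le> d * 2" using a \<mu> by (intro mult_left_mono) (auto simp: d_def)
      \<comment> \<open>The arithmetic-geometric inequality replaces the distance by its square,
        whose expectation is known. With \<open>q\<close> the root of \<open>n\<close>, both terms
        are of order \<open>1 / q\<close> in expectation.\<close>
      also have "\<dots> \<le> 1 / q + q * d\<^sup>2"
      proof -
        have "0 \<le> (1 - q * d)\<^sup>2" by simp
        then show ?thesis using q by (simp add: field_simps power2_eq_square)
      qed
      also have "q * d\<^sup>2 = (\<Sum>i<n. x i - \<mu>)\<^sup>2 / (q * real n)"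
      proof -
        have "a - \<mu> = (\<Sum>i<n. x i - \<mu>) / real n"
          using assms by (simp add: a_def sample_mean_def sum_subtractf field_simps)
        then have "q * d\<^sup>2 = q * (\<Sum>i<n. x i - \<mu>)\<^sup>2 / (real n * real n)"
          by (simp add: d_def power_divide power2_eq_square[of "real n"])
        also have "\<dots> = (\<Sum>i<n. x i - \<mu>)\<^sup>2 / (q * real n)"
          using q(1) unfolding q(2)[symmetric] by (simp add: field_simps)
        finally show ?thesis .
      qed
      finally show ?thesis unfolding a_def by linarith
    qed
    have "norm (\<Sum>z\<in>spins n. tilt \<mu> n z *\<^sub>R \<bar>(sample_mean n z)\<^sup>2 - m\<^sup>2\<bar>) =
      (\<Sum>z\<in>spins n. tilt \<mu> n z * \<bar>(sample_mean n z)\<^sup>2 - m\<^sup>2\<bar>)"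
      using tilt_nonneg[OF \<mu>] by (simp add: sum_nonneg)
    also have "\<dots> \<le> (\<Sum>z\<in>spins n. tilt \<mu> n z *
        (\<bar>\<mu>\<^sup>2 - m\<^sup>2\<bar> + 1 / q + (\<Sum>i<n. z i - \<mu>)\<^sup>2 / (q * real n)))"
      by (intro sum_mono mult_left_mono pt tilt_nonneg[OF \<mu>])
    also have "\<dots> = (\<Sum>z\<in>spins n. tilt \<mu> n z) * (\<bar>\<mu>\<^sup>2 - m\<^sup>2\<bar> + 1 / q) +
        (\<Sum>z\<in>spins n. tilt \<mu> n z * (\<Sum>i<n. z i - \<mu>)\<^sup>2) / (q * real n)"
      by (simp add: distrib_left sum.distrib sum_distrib_right sum_divide_distrib mult_ac)
    also have "\<dots> = \<bar>\<mu>\<^sup>2 - m\<^sup>2\<bar> + 1 / q + (1 - \<mu>\<^sup>2) / q"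
      unfolding sum_tilt tilt_variance using assms by simp
    also have "\<dots> \<le> \<bar>\<mu>\<^sup>2 - m\<^sup>2\<bar> + 1 / q + 1 / q"
      using q by (intro add_left_mono divide_right_mono) auto
    finally show "norm (\<Sum>z\<in>spins n. tilt \<mu> n z *\<^sub>R \<bar>(sample_mean n z)\<^sup>2 - m\<^sup>2\<bar>) \<le>
      2 / sqrt (real n) + 1 * \<bar>\<mu>\<^sup>2 - (cw_mag \<beta>)\<^sup>2\<bar>"
      by (simp add: q_def m_def)
  qed
  then show ?thesis by (simp add: m_def)
qed

subsection \<open>Characteristic functions\<close>

text \<open>Factor out the larger exponential, which is at most 1, and use
  \<open>1 - exp (- s) \<le> s\<close>. This turns a difference of variances into a difference of
  Gaussian characteristic functions.\<close>

lemma abs_exp_minus_diff_le: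
  fixes u w :: real
  assumes "u \<ge> 0" "w \<ge> 0"
  shows "\<bar>exp (- u) - exp (- w)\<bar> \<le> \<bar>u - w\<bar>"
proof -
  have *: "exp (- x) - exp (- y) \<le> y - x" if "0 \<le> x" "x \<le> y" for x y :: real
  proof -
    have "exp (- x) - exp (- y) = exp (- x) * (1 - exp (- (y - x)))"
      by (simp add: right_diff_distrib exp_add[symmetric])
    also have "\<dots> \<le> 1 * (1 - exp (- (y - x)))"
      using that by (intro mult_right_mono) auto
    also have "\<dots> \<le> y - x" using exp_ge_add_one_self[of "- (y - x)"] by (simp add: algebra_simps)
    finally show ?thesis .
  qed
  show ?thesis
  proof (cases "u \<le> w")
    case True
    then show ?thesis using *[of u w] assms by simp
  next
    case False
    then show ?thesis using *[of w u] assms by simp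
  qed
qed

lemma exp_minus_approx:
  fixes u :: real
  assumes "u \<ge> 0"
  shows "\<bar>exp (- u) - (1 - u)\<bar> \<le> u\<^sup>2 / 2"
proof -
  have "((\<lambda>u. 1 - u + u\<^sup>2 / 2 - exp (- u)) has_real_derivative - 1 + x + exp (- x)) (at x)" for x :: real
    by (auto intro!: derivative_eq_intros)
  moreover have "- 1 + x + exp (- x) \<ge> 0" for x :: real using exp_ge_add_one_self[of "-x"] by simp
  ultimately have "(\<lambda>u. 1 - u + u\<^sup>2 / 2 - exp (- u)) 0 \<le> (\<lambda>u. 1 - u + u\<^sup>2 / 2 - exp (- u)) u"
    using DERIV_nonneg_imp_nondecreasing[OF assms, of "\<lambda>u. 1 - u + u\<^sup>2 / 2 - exp (- u)"] by blast
  then show ?thesis using exp_ge_add_one_self[of "-u"] by simp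
qed

text \<open>The centred two-point law has mean 0 and variance \<open>1 - \<mu>\<^sup>2\<close>, so
  both terms equal \<open>1 - u\<close> to second order, with
  \<open>u = c\<^sup>2 * (1 - \<mu>\<^sup>2) / 2\<close>. The cubic error is the Taylor remainder of
  \<open>iexp\<close>, the quartic one that of the real exponential.\<close>

lemma two_point_char_approx:
  fixes \<mu> c :: real
  assumes "\<bar>\<mu>\<bar> \<le> 1"
  shows "cmod (of_real ((1 - \<mu>) / 2) * iexp (c * (- 1 - \<mu>)) + of_real ((1 + \<mu>) / 2) * iexp (c * (1 - \<mu>)) -
    of_real (exp (- (c\<^sup>2 * (1 - \<mu>\<^sup>2) / 2)))) \<le> 4 / 3 * \<bar>c\<bar> ^ 3 + c ^ 4 / 8"
proof -
  define T where "T x = (\<Sum>k\<le>2. (\<i> * complex_of_real x) ^ k / fact k)" for x :: real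
  have T: "T x = 1 + \<i> * x - of_real (x\<^sup>2 / 2)" for x
    by (simp add: T_def numeral_2_eq_2 complex_eq_iff power2_eq_square)
  \<comment> \<open>A deviation of a spin from \<open>\<mu>\<close> is at most 2 in absolute value,
    and \<open>2 ^ 3 / 6 = 4 / 3\<close>.\<close>
  have err: "cmod (iexp (c * y) - T (c * y)) \<le> 4 / 3 * \<bar>c\<bar> ^ 3" if "\<bar>y\<bar> \<le> 2" for y
  proof -
    have "cmod (iexp (c * y) - T (c * y)) \<le> \<bar>c * y\<bar> ^ 3 / 6"
      using iexp_approx1[of "c * y" 2] by (simp add: T_def eval_nat_numeral)
    also have "\<dots> \<le> (\<bar>c\<bar> * 2) ^ 3 / 6"
      using that by (intro divide_right_mono power_mono) (auto simp: abs_mult mult_left_mono)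
    finally show ?thesis by (simp add: power_mult_distrib)
  qed
  define p q where "p = (1 - \<mu>) / 2" and "q = (1 + \<mu>) / 2"
  have pq: "p \<ge> 0" "q \<ge> 0" "p + q = 1" using assms by (auto simp: p_def q_def field_simps)
  define u where "u = c\<^sup>2 * (1 - \<mu>\<^sup>2) / 2"
  have \<mu>2: "\<mu>\<^sup>2 \<le> 1" using assms by (simp add: abs_square_le_1)
  have u: "u \<ge> 0" using \<mu>2 by (simp add: u_def)
  have mean: "of_real p * T (c * (- 1 - \<mu>)) + of_real q * T (c * (1 - \<mu>)) = of_real (1 - u)"
    unfolding T p_def q_def u_def
    by (simp add: complex_eq_iff field_simps power2_eq_square)
  have "of_real p * iexp (c * (- 1 - \<mu>)) + of_real q * iexp (c * (1 - \<mu>)) - of_real (exp (- u)) =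
    of_real p * (iexp (c * (- 1 - \<mu>)) - T (c * (- 1 - \<mu>))) +
    of_real q * (iexp (c * (1 - \<mu>)) - T (c * (1 - \<mu>))) + (of_real (1 - u) - of_real (exp (- u)))"
    unfolding mean[symmetric] by (simp add: algebra_simps)
  also have "cmod \<dots> \<le> p * (4 / 3 * \<bar>c\<bar> ^ 3) + q * (4 / 3 * \<bar>c\<bar> ^ 3) + u\<^sup>2 / 2"
  proof (intro order.trans[OF norm_triangle_ineq] add_mono)
    show "cmod (of_real p * (iexp (c * (- 1 - \<mu>)) - T (c * (- 1 - \<mu>)))) \<le> p * (4 / 3 * \<bar>c\<bar> ^ 3)"
      unfolding norm_mult norm_of_real abs_of_nonneg[OF pq(1)]
      by (rule mult_left_mono[OF err pq(1)]) (use assms in linarith)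
    show "cmod (of_real q * (iexp (c * (1 - \<mu>)) - T (c * (1 - \<mu>)))) \<le> q * (4 / 3 * \<bar>c\<bar> ^ 3)"
      unfolding norm_mult norm_of_real abs_of_nonneg[OF pq(2)]
      by (rule mult_left_mono[OF err pq(2)]) (use assms in linarith)
    show "cmod (of_real (1 - u) - of_real (exp (- u))) \<le> u\<^sup>2 / 2"
      unfolding of_real_diff[symmetric] norm_of_real using exp_minus_approx[OF u] by (simp add: abs_minus_commute)
  qed
  also have "\<dots> = 4 / 3 * \<bar>c\<bar> ^ 3 * (p + q) + u\<^sup>2 / 2" by (simp add: algebra_simps)
  also have "\<dots> = 4 / 3 * \<bar>c\<bar> ^ 3 + u\<^sup>2 / 2" by (simp add: pq)
  also have "u\<^sup>2 / 2 \<le> c ^ 4 / 8"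
  proof -
    have "u \<le> c\<^sup>2 / 2" unfolding u_def by (intro divide_right_mono mult_left_le) auto
    then have "u\<^sup>2 \<le> (c\<^sup>2 / 2)\<^sup>2" using u by (intro power_mono)
    then show ?thesis by (simp add: power_divide)
  qed
  finally show ?thesis unfolding p_def q_def u_def by simp
qed

text \<open>Both quantities are products over the coordinates of factors of modulus at most 1, so
  their difference is at most the sum of the factorwise differences.\<close>

lemma tilt_char_approx:
  fixes c :: "nat \<Rightarrow> real"
  assumes "\<bar>\<mu>\<bar> \<le> 1" and c: "\<And>i. i < n \<Longrightarrow> \<bar>c i\<bar> \<le> d"
  shows "cmod ((\<Sum>y\<in>spins n. tilt \<mu> n y *\<^sub>R iexp (\<Sum>i<n. c i * (y i - \<mu>))) -
    of_real (exp (- ((1 - \<mu>\<^sup>2) * (\<Sum>i<n. (c i)\<^sup>2) / 2)))) \<le> real n * (4 / 3 * d ^ 3 + d ^ 4 / 8)"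
proof -
  define A where "A i = of_real ((1 - \<mu>) / 2) * iexp (c i * (- 1 - \<mu>)) +
    of_real ((1 + \<mu>) / 2) * iexp (c i * (1 - \<mu>))" for i
  define B where "B i = complex_of_real (exp (- ((c i)\<^sup>2 * (1 - \<mu>\<^sup>2) / 2)))" for i
  have \<mu>2: "\<mu>\<^sup>2 \<le> 1" using assms by (simp add: abs_square_le_1)
  have A: "(\<Sum>y\<in>spins n. tilt \<mu> n y *\<^sub>R iexp (\<Sum>i<n. c i * (y i - \<mu>))) = (\<Prod>i<n. A i)"
    using sum_tilt_prod[of \<mu> n "\<lambda>i s. iexp (c i * (s - \<mu>))"]
    by (simp add: A_def scaleR_conv_of_real sum_distrib_left exp_sum)
  have B: "of_real (exp (- ((1 - \<mu>\<^sup>2) * (\<Sum>i<n. (c i)\<^sup>2) / 2))) = (\<Prod>i<n. B i)"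
  proof -
    have "- ((1 - \<mu>\<^sup>2) * (\<Sum>i<n. (c i)\<^sup>2) / 2) = (\<Sum>i<n. - ((c i)\<^sup>2 * (1 - \<mu>\<^sup>2) / 2))"
      by (simp add: sum_distrib_left sum_divide_distrib sum_negf mult_ac)
    then show ?thesis unfolding B_def by (simp add: exp_sum del: of_real_exp)
  qed
  have "cmod (A i) \<le> 1" for i
  proof -
    have "cmod (A i) \<le> \<bar>(1 - \<mu>) / 2\<bar> * 1 + \<bar>(1 + \<mu>) / 2\<bar> * 1"
      unfolding A_def by (rule order.trans[OF norm_triangle_ineq]) (simp add: norm_mult del: of_real_mult of_real_divide of_real_diff)
    also have "\<dots> = 1" using assms(1) by (auto simp: field_simps abs_if)
    finally show ?thesis .
  qed
  moreover have "cmod (B i) \<le> 1" for i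
    unfolding B_def norm_of_real using \<mu>2 by simp
  ultimately have "cmod ((\<Prod>i<n. A i) - (\<Prod>i<n. B i)) \<le> (\<Sum>i<n. cmod (A i - B i))"
    by (intro norm_prod_diff) auto
  also have "\<dots> \<le> (\<Sum>i<n. 4 / 3 * d ^ 3 + d ^ 4 / 8)"
  proof (rule sum_mono)
    fix i assume "i \<in> {..<n}"
    then have ci: "\<bar>c i\<bar> \<le> d" using c by simp
    have "cmod (A i - B i) \<le> 4 / 3 * \<bar>c i\<bar> ^ 3 + (c i) ^ 4 / 8"
      unfolding A_def B_def by (rule two_point_char_approx[OF assms(1)])
    also have "\<dots> \<le> 4 / 3 * d ^ 3 + d ^ 4 / 8"
      using power_mono[OF ci, of 3] power_mono[OF ci, of 4] by (simp add: power_even_abs)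
    finally show "cmod (A i - B i) \<le> 4 / 3 * d ^ 3 + d ^ 4 / 8" .
  qed
  finally show ?thesis unfolding A B by simp
qed

section \<open>The law of the scaled covariance and its characteristic function\<close>

lemma cw_prob_nonneg: "cw_prob \<beta> n z \<ge> 0"
  by (auto simp: partition_fun_def ising_weight_def intro!: divide_nonneg_nonneg sum_nonneg)

lemma sum_cw_prob: "(\<Sum>z\<in>spins n. cw_prob \<beta> n z) = 1"
proof -
  have "partition_fun \<beta> (Q_CW n) n > 0"
    unfolding partition_fun_def ising_weight_def
    using finite_spins spins_nonempty by (intro sum_pos) auto
  then show ?thesis by (simp add: sum_divide_distrib[symmetric] partition_fun_def)
qed

lemma curie_weiss_eq: "curie_weiss \<beta> n = point_measure (spins n) (\<lambda>z. ennreal (cw_prob \<beta> n z))"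
  by (simp add: curie_weiss_def ising_measure_def)

lemma prob_space_curie_weiss: "prob_space (curie_weiss \<beta> n)"
proof
  show "emeasure (curie_weiss \<beta> n) (space (curie_weiss \<beta> n)) = 1"
    unfolding curie_weiss_eq
    by (simp add: space_point_measure emeasure_point_measure_finite finite_spins sum_ennreal
        cw_prob_nonneg sum_cw_prob)
qed

lemma integral_curie_weiss:
  fixes f :: "(nat \<Rightarrow> real) \<Rightarrow> 'a :: {banach, second_countable_topology}"
  shows "(\<integral>z. f z \<partial>curie_weiss \<beta> n) = (\<Sum>z\<in>spins n. cw_prob \<beta> n z *\<^sub>R f z)"
  unfolding curie_weiss_eq
  by (simp add: lebesgue_integral_point_measure_finite finite_spins cw_prob_nonneg)

text \<open>Both factors carry the discrete sigma-algebra on a finite set, and so does their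
  product; only the target space has to be respected.\<close>

lemma measurable_curie_weiss_pair:
  assumes "range f \<subseteq> space M"
  shows "f \<in> measurable (curie_weiss \<beta>1 n \<Otimes>\<^sub>M curie_weiss \<beta>2 n) M"
proof -
  have "f \<in> measurable (count_space (spins n) \<Otimes>\<^sub>M count_space (spins n)) M"
    using assms by (intro measurable_pair_measure_countable1 countable_finite finite_spins) auto
  moreover have "sets (curie_weiss \<beta>1 n \<Otimes>\<^sub>M curie_weiss \<beta>2 n) =
      sets (count_space (spins n) \<Otimes>\<^sub>M count_space (spins n))"
    by (intro sets_pair_measure_cong) (simp_all add: curie_weiss_eq sets_point_measure_count_space)
  ultimately show ?thesis by (simp cong: measurable_cong_sets)
qed

lemma real_distribution_scaled_cov_law: "real_distribution (scaled_cov_law \<beta>1 \<beta>2 n)"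
proof -
  interpret P: pair_prob_space "curie_weiss \<beta>1 n" "curie_weiss \<beta>2 n"
    by (simp add: pair_prob_space_def pair_sigma_finite_def prob_space_curie_weiss
        prob_space_imp_sigma_finite)
  show ?thesis
    unfolding scaled_cov_law_def
    by (intro P.real_distribution_distr measurable_curie_weiss_pair) auto
qed

text \<open>Fubini, with both integrals finite sums. The inner sum is the characteristic function
  conditional on \<open>X = x\<close>.\<close>

lemma char_scaled_cov_law:
  "char (scaled_cov_law \<beta>1 \<beta>2 n) t =
    (\<Sum>x\<in>spins n. cw_prob \<beta>1 n x *\<^sub>R (\<Sum>y\<in>spins n. cw_prob \<beta>2 n y *\<^sub>R
      iexp (t * (sqrt (real n) * sample_cov n x y))))"
proof -
  interpret P: pair_prob_space "curie_weiss \<beta>1 n" "curie_weiss \<beta>2 n"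
    by (simp add: pair_prob_space_def pair_sigma_finite_def prob_space_curie_weiss
        prob_space_imp_sigma_finite)
  define F where "F xy = iexp (t * (case xy of (x, y) \<Rightarrow> sqrt (real n) * sample_cov n x y))" for xy
  have "integrable (curie_weiss \<beta>1 n \<Otimes>\<^sub>M curie_weiss \<beta>2 n) F"
    by (rule P.integrable_const_bound[of _ 1]) (auto simp: F_def simp del: of_real_mult intro: measurable_curie_weiss_pair)
  from P.integral_fst'[OF this]
  have "(\<integral>xy. F xy \<partial>(curie_weiss \<beta>1 n \<Otimes>\<^sub>M curie_weiss \<beta>2 n)) =
    (\<Sum>x\<in>spins n. cw_prob \<beta>1 n x *\<^sub>R (\<Sum>y\<in>spins n. cw_prob \<beta>2 n y *\<^sub>R F (x, y)))"
    by (simp only: integral_curie_weiss)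
  moreover have "char (scaled_cov_law \<beta>1 \<beta>2 n) t = (\<integral>xy. F xy \<partial>(curie_weiss \<beta>1 n \<Otimes>\<^sub>M curie_weiss \<beta>2 n))"
    unfolding char_def scaled_cov_law_def F_def
    by (subst integral_distr) (auto intro!: measurable_curie_weiss_pair)
  ultimately show ?thesis by (simp add: F_def)
qed

section \<open>The conditional central limit estimate\<close>

lemma sum_centred: "n > 0 \<Longrightarrow> (\<Sum>i<n. x i - sample_mean n x) = 0"
  by (simp add: sum_subtractf sample_mean_def)

text \<open>Since the deviations of \<open>x\<close> sum to 0, any constant may replace the sample
  mean of \<open>y\<close>. Choosing the mean of the product law makes the summands independent and
  centred once \<open>x\<close> is fixed.\<close>

lemma sample_cov_recentre:
  assumes "n > 0"
  shows "sqrt (real n) * sample_cov n x y =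
    (\<Sum>i<n. (x i - sample_mean n x) / sqrt (real n) * (y i - \<mu>))"
proof -
  have "(\<Sum>i<n. (x i - sample_mean n x) * (y i - sample_mean n y)) =
    (\<Sum>i<n. (x i - sample_mean n x) * (y i - \<mu>)) - (\<Sum>i<n. x i - sample_mean n x) * (sample_mean n y - \<mu>)"
    unfolding sum_distrib_right sum_subtractf[symmetric] by (simp add: algebra_simps)
  then have "sample_cov n x y = (\<Sum>i<n. (x i - sample_mean n x) * (y i - \<mu>)) / (sqrt (real n) * sqrt (real n))"
    by (simp add: sample_cov_def sum_centred[OF assms])
  then have "sqrt (real n) * sample_cov n x y = (\<Sum>i<n. (x i - sample_mean n x) * (y i - \<mu>)) / sqrt (real n)"
    using assms by (metis nonzero_mult_divide_mult_cancel_left of_nat_0_less_iff order_less_irrefl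
        real_sqrt_gt_zero times_divide_eq_right)
  then show ?thesis by (simp add: sum_divide_distrib)
qed

lemma sum_centred_squares:
  assumes "n > 0" "x \<in> spins n"
  shows "(\<Sum>i<n. (x i - sample_mean n x)\<^sup>2) = real n * (1 - (sample_mean n x)\<^sup>2)"
proof -
  define a where "a = sample_mean n x"
  have "(\<Sum>i<n. (x i - a)\<^sup>2) = (\<Sum>i<n. (x i)\<^sup>2 - a\<^sup>2 - 2 * a * (x i - a))"
    by (simp add: power2_eq_square algebra_simps)
  also have "\<dots> = (\<Sum>i<n. (x i)\<^sup>2 - a\<^sup>2) - 2 * a * (\<Sum>i<n. x i - a)"
    unfolding sum_distrib_left by (rule sum_subtractf)
  also have "(\<Sum>i<n. x i - a) = 0" unfolding a_def by (rule sum_centred[OF assms(1)])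
  also have "(\<Sum>i<n. (x i)\<^sup>2 - a\<^sup>2) = (\<Sum>i<n. 1 - a\<^sup>2)"
    by (rule sum.cong) (use spins_cases[OF assms(2)] in force)+
  finally show ?thesis by (simp add: a_def)
qed

text \<open>The bound of \<open>tilt_char_approx\<close> for coefficients of size
  \<open>2 * \<bar>t\<bar> / sqrt n\<close>, which is what deviations of at most 2 produce. The
  cubic term gives order \<open>1 / sqrt n\<close>.\<close>

definition clt_error :: "real \<Rightarrow> nat \<Rightarrow> real" where
  "clt_error t n = real n * (4 / 3 * (2 * \<bar>t\<bar> / sqrt (real n)) ^ 3 + (2 * \<bar>t\<bar> / sqrt (real n)) ^ 4 / 8)"

lemma clt_error_tendsto_0: "clt_error t \<longlonglongrightarrow> 0"
proof -
  have "(\<lambda>n. 32 / 3 * \<bar>t\<bar> ^ 3 / sqrt (real n) + 2 * \<bar>t\<bar> ^ 4 / real n) \<longlonglongrightarrow> 0"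
    by real_asymp
  moreover have "eventually (\<lambda>n. 32 / 3 * \<bar>t\<bar> ^ 3 / sqrt (real n) + 2 * \<bar>t\<bar> ^ 4 / real n = clt_error t n) sequentially"
    using eventually_gt_at_top[of 0]
  proof eventually_elim
    case (elim n)
    define q where "q = sqrt (real n)"
    have q: "q > 0" "real n = q * q" using elim by (auto simp: q_def)
    show ?case
      unfolding clt_error_def q_def[symmetric] unfolding q(2) using q(1)
      by (simp add: field_simps eval_nat_numeral)
  qed
  ultimately show ?thesis by (rule Lim_transform_eventually)
qed

text \<open>For each \<open>\<mu>\<close> the conditional law is compared with a Gaussian of
  variance \<open>w = (1 - a\<^sup>2) * (1 - \<mu>\<^sup>2)\<close>, and then \<open>w\<close> with
  \<open>v\<close>. Mixing turns the deviation of \<open>\<mu>\<^sup>2\<close> into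
  \<open>mix_dev\<close>; that of \<open>a\<^sup>2\<close> from \<open>k\<^sup>2\<close> stays, to
  be averaged over \<open>x\<close> with \<open>k\<close> the magnetization of
  \<open>X\<close>.\<close>

lemma cond_char_bound:
  assumes "\<beta> \<ge> 0" "n > 0" "x \<in> spins n" "\<bar>k\<bar> \<le> 1"
  defines "v \<equiv> (1 - k\<^sup>2) * (1 - (cw_mag \<beta>)\<^sup>2)"
  shows "cmod (\<Sum>y\<in>spins n. cw_prob \<beta> n y *\<^sub>R
      (iexp (t * (sqrt (real n) * sample_cov n x y)) - of_real (exp (- (t\<^sup>2 * v / 2))))) \<le>
    clt_error t n + t\<^sup>2 / 2 * \<bar>(sample_mean n x)\<^sup>2 - k\<^sup>2\<bar> + t\<^sup>2 / 2 * mix_dev \<beta> n"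
proof (rule cw_expectation_bound[OF assms(1,2)])
  fix \<mu> :: real assume \<mu>: "\<bar>\<mu>\<bar> \<le> 1"
  define a m where "a = sample_mean n x" and "m = cw_mag \<beta>"
  define c where "c i = t * ((x i - a) / sqrt (real n))" for i
  have a: "\<bar>a\<bar> \<le> 1" unfolding a_def by (rule abs_sample_mean_le_1[OF assms(2,3)])
  have "\<bar>m\<bar> \<le> 1" using cw_mag_characterization[OF assms(1)] by (simp add: m_def)
  with a \<mu> assms(4) have sq: "a\<^sup>2 \<le> 1" "\<mu>\<^sup>2 \<le> 1" "k\<^sup>2 \<le> 1" "m\<^sup>2 \<le> 1"
    by (simp_all add: abs_square_le_1)
  have cov: "t * (sqrt (real n) * sample_cov n x y) = (\<Sum>i<n. c i * (y i - \<mu>))" for y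
    unfolding sample_cov_recentre[OF assms(2), of x y \<mu>] by (simp add: c_def a_def sum_distrib_left mult_ac)
  have c: "\<bar>c i\<bar> \<le> 2 * \<bar>t\<bar> / sqrt (real n)" if "i < n" for i
  proof -
    have "\<bar>x i - a\<bar> \<le> 2" using spins_cases[OF assms(3) that] a by auto
    then have "\<bar>t\<bar> * \<bar>x i - a\<bar> / sqrt (real n) \<le> \<bar>t\<bar> * 2 / sqrt (real n)"
      by (intro divide_right_mono mult_left_mono) auto
    then show ?thesis by (simp add: c_def abs_mult mult_ac)
  qed
  have "(\<Sum>i<n. (c i)\<^sup>2) = t\<^sup>2 / real n * (\<Sum>i<n. (x i - a)\<^sup>2)"
    by (simp add: c_def power_mult_distrib power_divide sum_distrib_left)
  also have "\<dots> = t\<^sup>2 * (1 - a\<^sup>2)"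
    using sum_centred_squares[OF assms(2,3)] assms(2) by (simp add: a_def)
  finally have c2: "(\<Sum>i<n. (c i)\<^sup>2) = t\<^sup>2 * (1 - a\<^sup>2)" .
  define E where "E = (\<Sum>y\<in>spins n. tilt \<mu> n y *\<^sub>R iexp (\<Sum>i<n. c i * (y i - \<mu>)))"
  define w where "w = (1 - a\<^sup>2) * (1 - \<mu>\<^sup>2)"
  have 1: "cmod (E - of_real (exp (- (t\<^sup>2 * w / 2)))) \<le> clt_error t n"
    using tilt_char_approx[of \<mu> n c, OF \<mu> c] unfolding E_def c2 clt_error_def w_def by (simp add: mult_ac)
  have "\<bar>exp (- (t\<^sup>2 * w / 2)) - exp (- (t\<^sup>2 * v / 2))\<bar> \<le> \<bar>t\<^sup>2 * w / 2 - t\<^sup>2 * v / 2\<bar>"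
    using sq by (intro abs_exp_minus_diff_le) (auto simp: w_def v_def m_def)
  also have "\<dots> = t\<^sup>2 / 2 * \<bar>w - v\<bar>"
  proof -
    have "t\<^sup>2 * w / 2 - t\<^sup>2 * v / 2 = t\<^sup>2 / 2 * (w - v)" by (simp add: algebra_simps)
    then show ?thesis by (simp only: abs_mult) simp
  qed
  also have "\<dots> \<le> t\<^sup>2 / 2 * (\<bar>a\<^sup>2 - k\<^sup>2\<bar> + \<bar>\<mu>\<^sup>2 - m\<^sup>2\<bar>)"
  proof (rule mult_left_mono)
    \<comment> \<open>The difference of the products is telescoped one factor at a time; the
      remaining factors lie in [0, 1].\<close>
    have "w - v = (1 - \<mu>\<^sup>2) * (k\<^sup>2 - a\<^sup>2) + (1 - k\<^sup>2) * (m\<^sup>2 - \<mu>\<^sup>2)"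
      by (simp add: w_def v_def m_def algebra_simps)
    also have "\<bar>\<dots>\<bar> \<le> 1 * \<bar>k\<^sup>2 - a\<^sup>2\<bar> + 1 * \<bar>m\<^sup>2 - \<mu>\<^sup>2\<bar>"
      using sq by (intro order.trans[OF abs_triangle_ineq] add_mono)
        (auto simp: abs_mult intro!: mult_right_mono mult_left_le_one_le)
    finally show "\<bar>w - v\<bar> \<le> \<bar>a\<^sup>2 - k\<^sup>2\<bar> + \<bar>\<mu>\<^sup>2 - m\<^sup>2\<bar>" by (simp add: abs_minus_commute)
  qed simp
  finally have 2: "cmod (of_real (exp (- (t\<^sup>2 * w / 2))) - of_real (exp (- (t\<^sup>2 * v / 2)))) \<le>
      t\<^sup>2 / 2 * (\<bar>a\<^sup>2 - k\<^sup>2\<bar> + \<bar>\<mu>\<^sup>2 - m\<^sup>2\<bar>)"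
    unfolding of_real_diff[symmetric] norm_of_real .
  have "(\<Sum>y\<in>spins n. tilt \<mu> n y *\<^sub>R
      (iexp (t * (sqrt (real n) * sample_cov n x y)) - of_real (exp (- (t\<^sup>2 * v / 2))))) =
    E - of_real (exp (- (t\<^sup>2 * v / 2)))"
    unfolding cov E_def scaleR_diff_right sum_subtractf scaleR_sum_left[symmetric] sum_tilt by simp
  also have "cmod \<dots> \<le> clt_error t n + t\<^sup>2 / 2 * (\<bar>a\<^sup>2 - k\<^sup>2\<bar> + \<bar>\<mu>\<^sup>2 - m\<^sup>2\<bar>)"
    by (rule norm_diff_triangle_le[OF 1 2])
  finally show "cmod (\<Sum>y\<in>spins n. tilt \<mu> n y *\<^sub>R
      (iexp (t * (sqrt (real n) * sample_cov n x y)) - of_real (exp (- (t\<^sup>2 * v / 2))))) \<le>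
    clt_error t n + t\<^sup>2 / 2 * \<bar>(sample_mean n x)\<^sup>2 - k\<^sup>2\<bar> + t\<^sup>2 / 2 * \<bar>\<mu>\<^sup>2 - (cw_mag \<beta>)\<^sup>2\<bar>"
    by (simp add: a_def m_def algebra_simps)
qed

text \<open>The conditional bound is uniform in \<open>x\<close> except for the distance of the
  squared sample mean from its limit, so averaging over \<open>x\<close> needs only the
  concentration of that square.\<close>

lemma char_scaled_cov_law_tendsto:
  fixes \<beta>1 \<beta>2 :: real
  assumes "\<beta>1 \<ge> 0" "\<beta>2 \<ge> 0"
  defines "v \<equiv> (1 - (cw_mag \<beta>1)\<^sup>2) * (1 - (cw_mag \<beta>2)\<^sup>2)"
  shows "(\<lambda>n. char (scaled_cov_law \<beta>1 \<beta>2 n) t) \<longlonglongrightarrow> of_real (exp (- (t\<^sup>2 * v / 2)))"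
proof -
  define e where "e = complex_of_real (exp (- (t\<^sup>2 * v / 2)))"
  \<comment> \<open>The three sources of error: the Gaussian approximation, the mixing variable of
    \<open>Y\<close>, and the squared sample mean of \<open>X\<close>.\<close>
  define r where "r n = clt_error t n + t\<^sup>2 / 2 * mix_dev \<beta>2 n +
    t\<^sup>2 / 2 * (2 / sqrt (real n) + mix_dev \<beta>1 n)" for n
  have m1: "\<bar>cw_mag \<beta>1\<bar> \<le> 1" using cw_mag_characterization[OF assms(1)] by simp
  have bound: "cmod (char (scaled_cov_law \<beta>1 \<beta>2 n) t - e) \<le> r n" if n: "n > 0" for n
  proof -
    define G where "G x = (\<Sum>y\<in>spins n. cw_prob \<beta>2 n y *\<^sub>R
      (iexp (t * (sqrt (real n) * sample_cov n x y)) - e))" for x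
    define s where "s x = \<bar>(sample_mean n x)\<^sup>2 - (cw_mag \<beta>1)\<^sup>2\<bar>" for x
    have "char (scaled_cov_law \<beta>1 \<beta>2 n) t - e = (\<Sum>x\<in>spins n. cw_prob \<beta>1 n x *\<^sub>R G x)"
      unfolding char_scaled_cov_law G_def scaleR_diff_right sum_subtractf
        scaleR_sum_left[symmetric] sum_cw_prob by simp
    also have "cmod \<dots> \<le> (\<Sum>x\<in>spins n. cw_prob \<beta>1 n x * cmod (G x))"
      by (rule order.trans[OF norm_sum]) (simp only: norm_scaleR abs_of_nonneg[OF cw_prob_nonneg] order_refl)
    also have "\<dots> \<le> (\<Sum>x\<in>spins n. cw_prob \<beta>1 n x *
        (clt_error t n + t\<^sup>2 / 2 * s x + t\<^sup>2 / 2 * mix_dev \<beta>2 n))"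
      unfolding G_def e_def v_def s_def
      by (intro sum_mono mult_left_mono cw_prob_nonneg cond_char_bound assms n m1)
    also have "\<dots> = (\<Sum>x\<in>spins n. cw_prob \<beta>1 n x) * (clt_error t n + t\<^sup>2 / 2 * mix_dev \<beta>2 n) +
        t\<^sup>2 / 2 * (\<Sum>x\<in>spins n. cw_prob \<beta>1 n x * s x)"
      unfolding sum_distrib_left sum_distrib_right sum.distrib[symmetric]
      by (intro sum.cong refl) algebra
    also have "\<dots> \<le> r n"
      unfolding sum_cw_prob r_def s_def
      by (simp only: mult_1) (intro add_left_mono mult_left_mono sample_mean_sq_concentration assms n; simp)
    finally show ?thesis .
  qed
  have "(\<lambda>n. 2 / sqrt (real n)) \<longlonglongrightarrow> 0" by real_asymp
  then have r: "r \<longlonglongrightarrow> 0 + t\<^sup>2 / 2 * 0 + t\<^sup>2 / 2 * (0 + 0)"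
    unfolding r_def using assms
    by (intro tendsto_intros clt_error_tendsto_0 mix_dev_tendsto_0) auto
  have "eventually (\<lambda>n. cmod (char (scaled_cov_law \<beta>1 \<beta>2 n) t - e) \<le> r n) sequentially"
    by (rule eventually_mono[OF eventually_gt_at_top[of 0] bound])
  then have "(\<lambda>n. char (scaled_cov_law \<beta>1 \<beta>2 n) t - e) \<longlonglongrightarrow> 0"
    by (rule Lim_null_comparison) (use r in simp)
  then show ?thesis unfolding e_def by (simp add: LIM_zero_iff)
qed

text \<open>The law is the image of the standard normal under scaling by \<open>\<sigma>\<close>,
  which evaluates the standard characteristic function at \<open>t * \<sigma>\<close>.\<close>

lemma char_normal_density:
  assumes "\<sigma> > 0"
  shows "char (density lborel (normal_density 0 \<sigma>)) t = of_real (exp (- (t\<^sup>2 * \<sigma>\<^sup>2 / 2)))"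
proof -
  interpret N: prob_space std_normal_distribution
    by (rule prob_space_normal_density) simp
  have "distributed std_normal_distribution lborel (\<lambda>x. x) std_normal_density"
    by (simp add: distributed_def normal_density_nonneg distr_id2)
  from N.normal_density_affine[OF this, of \<sigma> 0] assms
  have "distributed std_normal_distribution lborel (\<lambda>x. \<sigma> * x) (normal_density 0 \<sigma>)" by simp
  then have "density lborel (normal_density 0 \<sigma>) = distr std_normal_distribution lborel (\<lambda>x. \<sigma> * x)"
    by (simp add: distributed_def)
  then have "char (density lborel (normal_density 0 \<sigma>)) t = char std_normal_distribution (t * \<sigma>)"
    unfolding char_def by (subst \<open>density lborel _ = _\<close>, subst integral_distr) (auto simp: mult_ac)
  then show ?thesis
    by (simp add: char_std_normal_distribution power_mult_distrib del: of_real_exp)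
qed

theorem theorem2:
  fixes \<beta>1 \<beta>2 :: real
  assumes "\<beta>1 \<ge> 0" and "\<beta>2 \<ge> 0"
  defines "v \<equiv> (1 - (cw_mag \<beta>1)\<^sup>2) * (1 - (cw_mag \<beta>2)\<^sup>2)"
  shows "weak_conv_m (scaled_cov_law \<beta>1 \<beta>2) (density lborel (normal_density 0 (sqrt v)))
         \<and> (v = 1 \<longleftrightarrow> (\<beta>1 \<le> 1 \<and> \<beta>2 \<le> 1))
         \<and> (\<not> (\<beta>1 \<le> 1 \<and> \<beta>2 \<le> 1) \<longrightarrow> v < 1)"
proof -
  define p1 p2 where "p1 = (cw_mag \<beta>1)\<^sup>2" and "p2 = (cw_mag \<beta>2)\<^sup>2"
  have p: "0 \<le> p1" "p1 < 1" "0 \<le> p2" "p2 < 1" "p1 = 0 \<longleftrightarrow> \<beta>1 \<le> 1" "p2 = 0 \<longleftrightarrow> \<beta>2 \<le> 1"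
    using cw_mag_characterization[OF assms(1)] cw_mag_characterization[OF assms(2)]
    by (auto simp: p1_def p2_def power_less_one_iff abs_square_less_1)
  have v: "v = (1 - p1) * (1 - p2)" by (simp add: v_def p1_def p2_def)
  \<comment> \<open>Both magnetizations are strictly below 1, so the limit is a nondegenerate normal
    law and has a density.\<close>
  have "v > 0" using p unfolding v by simp
  have less: "v < 1" if "\<not> (\<beta>1 \<le> 1 \<and> \<beta>2 \<le> 1)"
  proof -
    have "v = 1 - p1 - p2 * (1 - p1)" by (simp add: v algebra_simps)
    moreover have "p1 > 0 \<or> p2 * (1 - p1) > 0" using that p by (metis diff_gt_0_iff_gt less_eq_real_def mult_pos_pos)
    moreover have "p2 * (1 - p1) \<ge> 0" using p by simp
    ultimately show ?thesis using p by linarith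
  qed
  have "v = 1" if "\<beta>1 \<le> 1 \<and> \<beta>2 \<le> 1" using that p by (simp add: v)
  moreover have "weak_conv_m (scaled_cov_law \<beta>1 \<beta>2) (density lborel (normal_density 0 (sqrt v)))"
  proof (rule levy_continuity[OF real_distribution_scaled_cov_law])
    show "real_distribution (density lborel (normal_density 0 (sqrt v)))"
      using \<open>v > 0\<close> prob_space_normal_density[of "sqrt v" 0]
      by (auto simp: real_distribution_def real_distribution_axioms_def)
    show "(\<lambda>n. char (scaled_cov_law \<beta>1 \<beta>2 n) t) \<longlonglongrightarrow> char (density lborel (normal_density 0 (sqrt v))) t" for t
      using char_scaled_cov_law_tendsto[OF assms(1,2), of t] \<open>v > 0\<close>
      by (simp add: char_normal_density v_def)
  qed
  ultimately show ?thesis using less by auto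
qed

end
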